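(* Let $(\tilde S,\tilde\alpha)$ be a finite cover of a finite area translation surface $(S,\alpha)$ with infinite topological type. Suppose that both $(S,\alpha)$ and $(\tilde S,\tilde\alpha)$ have translation flows which are defined for all time almost everywhere and are ergodic, and that additionally the translation flow on $(S,\alpha)$ is uniquely ergodic. Then the translation flow on the cover $(\tilde S,\tilde\alpha)$ is uniquely ergodic.
   Context: A translation surface $(S,\alpha)$ is a Riemann surface $S$ (not necessarily compact) with a holomorphic $1$-form $\alpha$. Away from the zeros of $\alpha$, the maps $q\mapsto\int_p^q\alpha$ give charts to $\mathbb C\cong\mathbb R^2$ that differ by translations; area and Lebesgue measure are pulled back from the plane. Infinite topological type means that the fundamental group is not finitely generated. The translation flow is $F^t(x,y)=(x+t,y)$ in these charts; it is defined for all time almost everywhere if for every $t\in\mathbb R$ the map $F^t$ is defined Lebesgue-a.e.; ergodic means ergodic with respect to Lebesgue measure; uniquely ergodic means that normalized Lebesgue measure is the only translation flow-invariant Borel probability measure. Covers are unbranched, of finite degree, and carry the pulled-back $1$-form. *)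

theory Defs
  imports "HOL-Probability.Probability" "HOL-Algebra.Generated_Groups"
begin

section \<open>Riemann surfaces and holomorphic 1-forms\<close>

type_synonym 'a chart = "'a set \<times> ('a \<Rightarrow> complex)"

text \<open>The change of coordinates from the chart \<open>c\<close> to the chart \<open>d\<close>, and the part of the
  \<open>c\<close>-coordinate plane on which it is meaningful.\<close>

definition transition :: "'a chart \<Rightarrow> 'a chart \<Rightarrow> complex \<Rightarrow> complex"
  where "transition c d = snd d \<circ> inv_into (fst c) (snd c)"

definition overlap :: "'a chart \<Rightarrow> 'a chart \<Rightarrow> complex set"
  where "overlap c d = snd c ` (fst c \<inter> fst d)"

text \<open>The surface is the whole type \<open>'a\<close>; the Hausdorff property and second countability are
  part of the sort. The atlas need not be maximal.\<close>

definition riemann_surface :: "'a::{t2_space,second_countable_topology} chart set \<Rightarrow> bool"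
  where "riemann_surface \<A> \<longleftrightarrow>
    connected (UNIV :: 'a set) \<and>
    (\<Union>c\<in>\<A>. fst c) = UNIV \<and>
    (\<forall>c\<in>\<A>. open (fst c) \<and> open (snd c ` fst c) \<and>
       homeomorphism (fst c) (snd c ` fst c) (snd c) (inv_into (fst c) (snd c))) \<and>
    (\<forall>c\<in>\<A>. \<forall>d\<in>\<A>. transition c d holomorphic_on overlap c d)"

text \<open>A 1-form is given by its coefficient functions: in the coordinate \<open>z\<close> of a chart \<open>c\<close> it reads
  \<open>\<alpha> c z dz\<close>. Values of \<open>\<alpha> c\<close> outside the image of the chart are irrelevant.\<close>

type_synonym 'a form = "'a chart \<Rightarrow> complex \<Rightarrow> complex"

definition holomorphic_form :: "'a chart set \<Rightarrow> 'a form \<Rightarrow> bool"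
  where "holomorphic_form \<A> \<alpha> \<longleftrightarrow>
    (\<forall>c\<in>\<A>. \<alpha> c holomorphic_on snd c ` fst c) \<and>
    (\<forall>c\<in>\<A>. \<forall>d\<in>\<A>. \<forall>z\<in>overlap c d.
       \<alpha> c z = \<alpha> d (transition c d z) * deriv (transition c d) z)"

definition form_zeros :: "'a chart set \<Rightarrow> 'a form \<Rightarrow> 'a set"
  where "form_zeros \<A> \<alpha> = {x. \<exists>c\<in>\<A>. x \<in> fst c \<and> \<alpha> c (snd c x) = 0}"

definition translation_surface ::
    "'a::{t2_space,second_countable_topology} chart set \<Rightarrow> 'a form \<Rightarrow> bool"
  where "translation_surface \<A> \<alpha> \<longleftrightarrow>
    riemann_surface \<A> \<and> holomorphic_form \<A> \<alpha> \<and> form_zeros \<A> \<alpha> \<noteq> UNIV"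


section \<open>Translation charts and area\<close>

text \<open>A translation chart is an injective primitive \<open>\<psi>\<close> of \<open>\<alpha>\<close> on an open set, that is, up to an
  additive constant, \<open>\<psi> q\<close> is the integral of \<open>\<alpha>\<close> from a base point to \<open>q\<close>. Injectivity
  keeps \<open>V\<close> away from the zeros of \<open>\<alpha>\<close>.\<close>

definition translation_chart ::
    "'a::topological_space chart set \<Rightarrow> 'a form \<Rightarrow> 'a set \<Rightarrow> ('a \<Rightarrow> complex) \<Rightarrow> bool"
  where "translation_chart \<A> \<alpha> V \<psi> \<longleftrightarrow>
    open V \<and> inj_on \<psi> V \<and>
    (\<forall>c\<in>\<A>. \<forall>z\<in>overlap c (V, \<psi>). (transition c (V, \<psi>) has_field_derivative \<alpha> c z) (at z))"

text \<open>The area (Lebesgue) measure is the Borel measure which is planar Lebesgue measure in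
  translation charts and for which the (discrete) set of zeros of \<open>\<alpha>\<close> is null. It exists and is
  unique, since countably many translation charts cover the complement of the zeros and two such
  charts differ locally by a translation.\<close>

definition is_area_measure ::
    "'a::topological_space chart set \<Rightarrow> 'a form \<Rightarrow> 'a measure \<Rightarrow> bool"
  where "is_area_measure \<A> \<alpha> M \<longleftrightarrow>
    sets M = sets borel \<and>
    (\<forall>V \<psi> A. translation_chart \<A> \<alpha> V \<psi> \<and> A \<in> sets borel \<and> A \<subseteq> V \<longrightarrow>
       emeasure M A = emeasure lborel (\<psi> ` A)) \<and>
    emeasure M (form_zeros \<A> \<alpha>) = 0"

definition area_measure :: "'a::topological_space chart set \<Rightarrow> 'a form \<Rightarrow> 'a measure"
  where "area_measure \<A> \<alpha> = (THE M. is_area_measure \<A> \<alpha> M)"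

definition finite_area :: "'a::topological_space chart set \<Rightarrow> 'a form \<Rightarrow> bool"
  where "finite_area \<A> \<alpha> \<longleftrightarrow> emeasure (area_measure \<A> \<alpha>) UNIV < \<infinity>"

definition normalized_area :: "'a::topological_space chart set \<Rightarrow> 'a form \<Rightarrow> 'a measure"
  where "normalized_area \<A> \<alpha> =
    scale_measure (1 / emeasure (area_measure \<A> \<alpha>) UNIV) (area_measure \<A> \<alpha>)"


section \<open>The translation flow\<close>

text \<open>\<open>\<gamma>\<close> is, on the time interval between 0 and \<open>t\<close> (of either sign), a curve that
  moves in translation charts by \<open>(x, y) \<mapsto> (x + s, y)\<close>.\<close>

definition trajectory ::
    "'a::topological_space chart set \<Rightarrow> 'a form \<Rightarrow> real \<Rightarrow> (real \<Rightarrow> 'a) \<Rightarrow> bool"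
  where "trajectory \<A> \<alpha> t \<gamma> \<longleftrightarrow>
    (\<forall>s\<in>closed_segment 0 t. \<exists>V \<psi>. translation_chart \<A> \<alpha> V \<psi> \<and> \<gamma> s \<in> V \<and>
       (\<forall>\<^sub>F r in at s within closed_segment 0 t.
          \<gamma> r \<in> V \<and> \<psi> (\<gamma> r) = \<psi> (\<gamma> s) + of_real (r - s)))"

text \<open>\<open>F\<^sup>t\<close> is a partial map of the surface (its trajectories may run into a zero of \<open>\<alpha>\<close> or leave
  the surface in finite time), represented by its graph. Its domain of definition is \<open>Domain\<close> of
  the graph, and the preimage of \<open>A\<close> is \<open>(translation_flow \<A> \<alpha> t)\<inverse> `` A\<close>.\<close>

definition translation_flow ::
    "'a::topological_space chart set \<Rightarrow> 'a form \<Rightarrow> real \<Rightarrow> ('a \<times> 'a) set"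
  where "translation_flow \<A> \<alpha> t = {(p, q). \<exists>\<gamma>. trajectory \<A> \<alpha> t \<gamma> \<and> \<gamma> 0 = p \<and> \<gamma> t = q}"

definition flow_defined_ae :: "'a::topological_space chart set \<Rightarrow> 'a form \<Rightarrow> bool"
  where "flow_defined_ae \<A> \<alpha> \<longleftrightarrow>
    (\<forall>t. AE p in area_measure \<A> \<alpha>. p \<in> Domain (translation_flow \<A> \<alpha> t))"

text \<open>As the maps \<open>F\<^sup>t\<close> are only defined almost everywhere, invariance of sets is understood
  modulo null sets.\<close>

definition flow_ergodic :: "'a::topological_space chart set \<Rightarrow> 'a form \<Rightarrow> bool"
  where "flow_ergodic \<A> \<alpha> \<longleftrightarrow>
    (\<forall>A\<in>sets borel.
       (\<forall>t. AE p in area_measure \<A> \<alpha>. p \<in> (translation_flow \<A> \<alpha> t)\<inverse> `` A \<longleftrightarrow> p \<in> A) \<longrightarrow>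
       emeasure (area_measure \<A> \<alpha>) A = 0 \<or> emeasure (area_measure \<A> \<alpha>) (- A) = 0)"

text \<open>The case \<open>A = UNIV\<close> says that each \<open>F\<^sup>t\<close> is defined \<open>\<nu>\<close>-almost everywhere. In particular a
  point mass at a zero of \<open>\<alpha>\<close> is not invariant.\<close>

definition flow_invariant ::
    "'a::topological_space chart set \<Rightarrow> 'a form \<Rightarrow> 'a measure \<Rightarrow> bool"
  where "flow_invariant \<A> \<alpha> \<nu> \<longleftrightarrow>
    (\<forall>t. \<forall>A\<in>sets borel. emeasure \<nu> ((translation_flow \<A> \<alpha> t)\<inverse> `` A) = emeasure \<nu> A)"

definition uniquely_ergodic :: "'a::topological_space chart set \<Rightarrow> 'a form \<Rightarrow> bool"
  where "uniquely_ergodic \<A> \<alpha> \<longleftrightarrow>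
    {\<nu>. sets \<nu> = sets borel \<and> prob_space \<nu> \<and> flow_invariant \<A> \<alpha> \<nu>} = {normalized_area \<A> \<alpha>}"


section \<open>Finite covers\<close>

text \<open>\<open>p\<close> is an unbranched holomorphic cover of finite degree and \<open>\<beta>\<close> is the pullback of \<open>\<alpha>\<close>
  under \<open>p\<close>.\<close>

definition finite_translation_cover ::
    "'b::topological_space chart set \<Rightarrow> 'b form \<Rightarrow> 'a::topological_space chart set \<Rightarrow> 'a form \<Rightarrow>
     ('b \<Rightarrow> 'a) \<Rightarrow> bool"
  where "finite_translation_cover \<B> \<beta> \<A> \<alpha> p \<longleftrightarrow>
    covering_space UNIV p UNIV \<and>
    (\<exists>d>0. \<forall>x. card (p -` {x}) = d) \<and>
    (\<forall>b\<in>\<B>. \<forall>a\<in>\<A>. \<forall>y\<in>fst b \<inter> p -` fst a.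
       let g = snd a \<circ> p \<circ> inv_into (fst b) (snd b) in
         g field_differentiable at (snd b y) \<and>
         \<beta> b (snd b y) = \<alpha> a (snd a (p y)) * deriv g (snd b y))"


section \<open>Infinite topological type\<close>

definition loops :: "'a::topological_space set \<Rightarrow> 'a \<Rightarrow> (real \<Rightarrow> 'a) set"
  where "loops S x = {g. path g \<and> path_image g \<subseteq> S \<and> pathstart g = x \<and> pathfinish g = x}"

definition loop_class :: "'a::topological_space set \<Rightarrow> 'a \<Rightarrow> (real \<Rightarrow> 'a) \<Rightarrow> (real \<Rightarrow> 'a) set"
  where "loop_class S x g = {h \<in> loops S x. homotopic_paths S g h}"

definition fundamental_group :: "'a::topological_space set \<Rightarrow> 'a \<Rightarrow> (real \<Rightarrow> 'a) set monoid"
  where "fundamental_group S x =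
    \<lparr>carrier = loop_class S x ` loops S x,
     mult = (\<lambda>P Q. \<Union>g\<in>P. \<Union>h\<in>Q. loop_class S x (g +++ h)),
     one = loop_class S x (\<lambda>_. x)\<rparr>"

definition finitely_generated_group :: "('g, 'm) monoid_scheme \<Rightarrow> bool"
  where "finitely_generated_group G \<longleftrightarrow>
    (\<exists>H. finite H \<and> H \<subseteq> carrier G \<and> generate G H = carrier G)"

text \<open>For path-connected \<open>S\<close> the choice of the base point does not matter.\<close>

definition infinite_topological_type :: "'a::topological_space set \<Rightarrow> bool"
  where "infinite_topological_type S \<longleftrightarrow>
    (\<exists>x\<in>S. \<not> finitely_generated_group (fundamental_group S x))"

end

theory Submission
  imports Defs "HOL-Complex_Analysis.Conformal_Mappings"
begin

text \<open>Let \<open>\<nu>\<close> be an invariant probability measure on the cover. Its image under \<open>p\<close> is invariant on the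
  base, hence is the normalized area there. As \<open>p\<close> locally preserves area, \<open>\<nu>\<close> is absolutely
  continuous with respect to the area of the cover, and an invariant probability measure which is
  absolutely continuous with respect to an ergodic one equals it. That the area is itself invariant
  holds because each \<open>F\<^sup>t\<close> is an injective local translation between open sets, which have full
  measure by assumption.\<close>

section \<open>Measure theory\<close>

text \<open>Absolute continuity is obtained from null sets alone. The covering map sends an
  area-null set \<open>E\<close> into an area-null set \<open>N\<close> of the base, and then
  \<nu>(E) \<le> \<nu>(p^-1 N) = (p_* \<nu>)(N) = 0, because p_* \<nu> is the normalized area. The
  degree enters once: it bounds the area of the cover by a multiple of the area of the base, so that
  the area of the cover can be normalized. The obstacle is that neither the measure nor the flow is
  given as a usable object. \<open>area_measure\<close> is a definite description, so existence and
  uniqueness must be proved. F^t is only the graph of a relation defined through curves; that it is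
  single-valued, injective, additive in time, and a translation in charts on an open domain has to
  be extracted from these curves, largely by connectedness of time intervals. Measurability of
  images is part of the task, and is reached by cutting sets into countably many pieces that lie in
  charts.\<close>

lemma continuous_on_vimage_borel:
  fixes f :: "'a::topological_space \<Rightarrow> 'b::topological_space"
  assumes "continuous_on S f" "S \<in> sets borel" "X \<in> sets borel"
  shows "S \<inter> f -` X \<in> sets borel"
proof -
  have "f \<in> borel_measurable (restrict_space borel S)"
    by (rule borel_measurable_continuous_on_restrict[OF assms(1)])
  from measurable_sets[OF this assms(3)] show ?thesis
    using assms(2) by (simp add: sets_restrict_space_iff space_restrict_space Int_commute)
qed

text \<open>The image is a preimage under the continuous inverse \<open>g\<close>; a continuous
  image of a Borel set need not be Borel in general.\<close>

lemma homeomorphism_image_borel: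
  assumes "homeomorphism S T f g" "T \<in> sets borel" "X \<in> sets borel" "X \<subseteq> S"
  shows "f ` X \<in> sets borel"
proof -
  have "f ` X = T \<inter> g -` X"
    using assms(1,4) unfolding homeomorphism_def by (force simp: image_iff)
  then show ?thesis
    using continuous_on_vimage_borel[of T g X] assms unfolding homeomorphism_def by metis
qed

text \<open>Lindelof, in the form that turns a local property into a sequence of open sets.
  \<open>P {}\<close> supplies a member even when the extracted family is empty, so that the
  naturals can enumerate it.\<close>

lemma countable_open_cover:
  fixes P :: "'a::second_countable_topology set \<Rightarrow> bool"
  assumes "\<And>x. x \<in> E \<Longrightarrow> \<exists>U. open U \<and> x \<in> U \<and> P U" "P {}"
  obtains U :: "nat \<Rightarrow> 'a set" where "\<And>n. open (U n)" "\<And>n. P (U n)" "E \<subseteq> (\<Union>n. U n)"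
proof -
  obtain F where F: "F \<subseteq> {U. open U \<and> P U}" "countable F" "\<Union>F = \<Union>{U. open U \<and> P U}"
    by (rule Lindelof[of "{U. open U \<and> P U}"]) auto
  let ?U = "from_nat_into (insert {} F)"
  have r: "range ?U = insert {} F"
    using F(2) by (intro range_from_nat_into) auto
  show thesis
  proof (rule that[of ?U])
    fix n
    have "?U n \<in> insert {} F" using r by blast
    then show "open (?U n)" "P (?U n)" using F(1) assms(2) by auto
  next
    have "E \<subseteq> \<Union>{U. open U \<and> P U}" using assms(1) by blast
    then show "E \<subseteq> (\<Union>n. ?U n)" using F(3) r by (metis Union_insert Un_empty_left)
  qed
qed

text \<open>After making a countable cover disjoint, injectivity keeps the images disjoint, so both
  measures are sums over the same pieces. This is the common local-to-global step for chart changes,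
  for F^t and for the covering map. The local hypothesis speaks of all Borel subsets because the
  disjoint pieces are no longer open.\<close>

lemma image_measure_preserving_local:
  fixes g :: "'a::second_countable_topology \<Rightarrow> 'b"
  assumes sM: "sets M = sets borel" and E: "E \<in> sets borel" and inj: "inj_on g E"
    and loc: "\<And>x. x \<in> E \<Longrightarrow> \<exists>U. open U \<and> x \<in> U \<and>
      (\<forall>X\<in>sets borel. X \<subseteq> U \<inter> E \<longrightarrow> g ` X \<in> sets N \<and> emeasure N (g ` X) = emeasure M X)"
  shows "g ` E \<in> sets N" "emeasure N (g ` E) = emeasure M E"
proof -
  obtain U :: "nat \<Rightarrow> 'a set" where U: "\<And>n. open (U n)" "E \<subseteq> (\<Union>n. U n)"
    "\<And>n X. X \<in> sets borel \<Longrightarrow> X \<subseteq> U n \<inter> E \<Longrightarrow> g ` X \<in> sets N \<and> emeasure N (g ` X) = emeasure M X"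
  proof (rule countable_open_cover[of E "\<lambda>U. \<forall>X\<in>sets borel. X \<subseteq> U \<inter> E \<longrightarrow>
          g ` X \<in> sets N \<and> emeasure N (g ` X) = emeasure M X", OF loc], goal_cases)
    case (3 U)
    show thesis by (rule 3(1)[of U]) (use 3(2-) in blast)+
  qed auto
  define D where "D n = E \<inter> disjointed U n" for n
  have "range U \<subseteq> sets borel" using U(1) by auto
  then have "range (disjointed U) \<subseteq> sets borel"
    by (rule sets.range_disjointed_sets)
  then have Db: "D n \<in> sets borel" for n using E unfolding D_def by auto
  have DU: "D n \<subseteq> U n \<inter> E" for n unfolding D_def using disjointed_subset[of U n] by auto
  have UD: "(\<Union>n. D n) = E" using U(2) UN_disjointed_eq[of U] unfolding D_def by auto
  have dD: "disjoint_family D"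
    using disjoint_family_disjointed[of U] unfolding D_def disjoint_family_on_def by blast
  have dg: "disjoint_family (\<lambda>n. g ` D n)"
    unfolding disjoint_family_on_def
  proof safe
    fix m n :: nat and x y assume "m \<noteq> n" "x \<in> D m" "y \<in> D n" "g x = g y"
    then have "x = y" using inj DU by (meson IntD2 inj_onD subsetD)
    then show "g x \<in> {}" using dD \<open>m \<noteq> n\<close> \<open>x \<in> D m\<close> \<open>y \<in> D n\<close>
      unfolding disjoint_family_on_def by blast
  qed
  have gN: "g ` D n \<in> sets N" "emeasure N (g ` D n) = emeasure M (D n)" for n
    using U(3)[OF Db DU] by blast+
  have gE: "g ` E = (\<Union>n. g ` D n)" using UD by auto
  show "g ` E \<in> sets N" unfolding gE using gN(1) by auto
  have "emeasure N (g ` E) = (\<Sum>n. emeasure N (g ` D n))"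
    unfolding gE using gN(1) dg by (intro suminf_emeasure[symmetric]) auto
  also have "\<dots> = (\<Sum>n. emeasure M (D n))" by (simp add: gN(2))
  also have "\<dots> = emeasure M (\<Union>n. D n)" using Db dD sM by (intro suminf_emeasure) auto
  finally show "emeasure N (g ` E) = emeasure M E" using UD by simp
qed

lemma homeomorphism_imp_inj_on: "homeomorphism S T f g \<Longrightarrow> inj_on f S"
  unfolding homeomorphism_def by (metis inj_on_inverseI)

lemma emeasure_lborel_translate:
  fixes c :: "'a::euclidean_space"
  assumes "X \<in> sets borel"
  shows "(\<lambda>x. x + c) ` X \<in> sets borel" "emeasure lborel ((\<lambda>x. x + c) ` X) = emeasure lborel X"
proof -
  have eq: "(\<lambda>x. x + c) ` X = (+) (- c) -` X" by (force simp: image_iff)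
  have m: "(+) (- c) \<in> borel_measurable borel" by measurable
  show "(\<lambda>x. x + c) ` X \<in> sets borel"
    unfolding eq using measurable_sets[OF m assms] by simp
  have "emeasure lborel X = emeasure (distr lborel borel ((+) (- c))) X"
    by (simp add: lborel_distr_plus)
  also have "\<dots> = emeasure lborel ((+) (- c) -` X)"
    using assms by (subst emeasure_distr) auto
  finally show "emeasure lborel ((\<lambda>x. x + c) ` X) = emeasure lborel X" unfolding eq by simp
qed

lemma suminf_swap_ennreal:
  fixes f :: "nat \<Rightarrow> nat \<Rightarrow> ennreal"
  shows "(\<Sum>i. \<Sum>j. f i j) = (\<Sum>j. \<Sum>i. f i j)"
  using nn_integral_suminf[of "\<lambda>i j. f i j" "count_space UNIV"]
  by (simp add: nn_integral_count_space_nat)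

text \<open>The difference \<open>g - f\<close> has integral 0; finiteness of the integral is what
  makes subtraction in \<open>ennreal\<close> compatible with integration.\<close>

lemma AE_eq_of_nn_integral_eq:
  fixes f g :: "'a \<Rightarrow> ennreal"
  assumes [measurable]: "f \<in> borel_measurable M" "g \<in> borel_measurable M"
    and le: "AE x in M. f x \<le> g x" and eq: "integral\<^sup>N M f = integral\<^sup>N M g"
    and fin: "integral\<^sup>N M g \<noteq> \<infinity>"
  shows "AE x in M. f x = g x"
proof -
  have "(\<integral>\<^sup>+x. g x - f x \<partial>M) = integral\<^sup>N M g - integral\<^sup>N M f"
    using le fin eq by (intro nn_integral_diff) auto
  also have "\<dots> = 0" using eq fin by (simp add: diff_eq_0_iff_ennreal less_top)
  finally have "AE x in M. g x - f x = 0" by (subst (asm) nn_integral_0_iff_AE) auto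
  then show ?thesis using le by eventually_elim (auto simp: diff_eq_0_iff_ennreal)
qed

text \<open>With \<open>A\<close> the set where the density \<open>dN/dM\<close> exceeds \<open>1\<close>, invariance of both measures gives
  \<open>N (A - T A) - M (A - T A) = N (T A - A) - M (T A - A)\<close>; the left-hand side is nonnegative, the
  right-hand side is nonpositive, hence \<open>A\<close> is invariant modulo null sets.\<close>

lemma absolutely_continuous_invariant_eq_ergodic:
  fixes T :: "'t \<Rightarrow> 'a set \<Rightarrow> 'a set"
  assumes "prob_space M" "prob_space N" and ac: "absolutely_continuous M N"
    and sN: "sets N = sets M"
    and T: "\<And>t A. A \<in> sets M \<Longrightarrow> T t A \<in> sets M"
    and TM: "\<And>t A. A \<in> sets M \<Longrightarrow> emeasure M (T t A) = emeasure M A"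
    and TN: "\<And>t A. A \<in> sets M \<Longrightarrow> emeasure N (T t A) = emeasure N A"
    and erg: "\<And>A. A \<in> sets M \<Longrightarrow> (\<And>t. AE x in M. x \<in> T t A \<longleftrightarrow> x \<in> A) \<Longrightarrow>
      emeasure M A = 0 \<or> emeasure M (space M - A) = 0"
  shows "N = M"
proof -
  interpret M: prob_space M by fact
  interpret N: prob_space N by fact
  obtain f where f [measurable]: "f \<in> borel_measurable M" and Nf: "density M f = N"
    using M.Radon_Nikodym[OF ac sN] by blast
  have eN: "emeasure N X = (\<integral>\<^sup>+x. f x * indicator X x \<partial>M)" if "X \<in> sets M" for X
    using that unfolding Nf[symmetric] by (rule emeasure_density[OF f])
  have sp: "space N = space M" using sN by (rule sets_eq_imp_space_eq)
  define A where "A = {x \<in> space M. f x > 1}"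
  have A [measurable]: "A \<in> sets M" unfolding A_def by measurable
  have "AE x in M. x \<in> T t A \<longleftrightarrow> x \<in> A" for t
  proof -
    let ?B = "T t A"
    have B [measurable]: "?B \<in> sets M" by (rule T[OF A])
    \<comment> \<open>Both sides equal the common mass of \<open>A\<close> and \<open>?B\<close>
      minus the mass of their intersection. It is stated for a general \<open>K\<close> since it
      serves for \<open>M\<close> and for \<open>N\<close>.\<close>
    have diffs: "emeasure K (A - ?B) = emeasure K (?B - A)"
      if K: "prob_space K" "sets K = sets M" "emeasure K ?B = emeasure K A" for K
    proof -
      interpret K: prob_space K by fact
      have AB: "A \<in> sets K" "?B \<in> sets K" using K(2) by auto
      have "A \<inter> ?B \<union> (A - ?B) = A" "A \<inter> ?B \<union> (?B - A) = ?B"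
        "A \<inter> ?B \<inter> (A - ?B) = {}" "A \<inter> ?B \<inter> (?B - A) = {}" by blast+
      then have "measure K A = measure K (A \<inter> ?B) + measure K (A - ?B)"
        "measure K ?B = measure K (A \<inter> ?B) + measure K (?B - A)"
        using K.finite_measure_Union[of "A \<inter> ?B"] AB by (metis sets.Diff sets.Int)+
      then show ?thesis using K(3) by (simp add: K.emeasure_eq_measure)
    qed
    have dM: "emeasure M (A - ?B) = emeasure M (?B - A)"
      by (rule diffs) (use TM[OF A] in \<open>auto intro: M.prob_space_axioms\<close>)
    have "emeasure N (A - ?B) = emeasure N (?B - A)"
      by (rule diffs) (use TN[OF A] sN in \<open>auto intro: N.prob_space_axioms\<close>)
    also have "\<dots> = (\<integral>\<^sup>+x. f x * indicator (?B - A) x \<partial>M)" by (rule eN) simp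
    also have "\<dots> \<le> (\<integral>\<^sup>+x. indicator (?B - A) x \<partial>M)"
      by (intro nn_integral_mono) (auto simp: A_def indicator_def)
    also have "\<dots> = emeasure M (A - ?B)" by (simp add: dM)
    finally have le: "emeasure N (A - ?B) \<le> emeasure M (A - ?B)" .
    have "(\<integral>\<^sup>+x. indicator (A - ?B) x \<partial>M) \<le> (\<integral>\<^sup>+x. f x * indicator (A - ?B) x \<partial>M)"
      by (intro nn_integral_mono) (auto simp: A_def indicator_def)
    with le have eq: "(\<integral>\<^sup>+x. indicator (A - ?B) x \<partial>M) = (\<integral>\<^sup>+x. f x * indicator (A - ?B) x \<partial>M)"
      by (simp add: eN)
    have "AE x in M. indicator (A - ?B) x = f x * indicator (A - ?B) x"
    proof (rule AE_eq_of_nn_integral_eq[OF _ _ _ eq])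
      show "(\<integral>\<^sup>+x. f x * indicator (A - ?B) x \<partial>M) \<noteq> \<infinity>"
        unfolding eq[symmetric] by (simp add: less_top[symmetric])
      show "AE x in M. indicator (A - ?B) x \<le> f x * indicator (A - ?B) x"
        by (rule AE_I2) (auto simp: A_def indicator_def)
    qed measurable
    \<comment> \<open>The inequality \<open>f x > 1\<close> is strict on \<open>A\<close>, so the
      equality just obtained cannot hold at a point of \<open>A - ?B\<close>.\<close>
    then have AE1: "AE x in M. x \<notin> A - ?B"
    proof eventually_elim
      case (elim x)
      then show ?case by (cases "x \<in> A - ?B") (auto simp: A_def)
    qed
    have "A - ?B \<in> null_sets M"
      by (subst AE_iff_null_sets) (use AE1 in auto)
    then have "?B - A \<in> null_sets M" using dM by (auto simp: null_sets_def)
    then have "AE x in M. x \<notin> ?B - A" by (rule AE_not_in)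
    with AE1 show ?thesis by eventually_elim auto
  qed
  then consider "emeasure M A = 0" | "emeasure M (space M - A) = 0" using erg[OF A] by blast
  then have fle: "(AE x in M. f x \<le> 1) \<or> (AE x in M. 1 \<le> f x)"
  proof cases
    case 1
    then have "AE x in M. x \<notin> A" by (intro AE_not_in) (auto simp: null_sets_def)
    then have "AE x in M. f x \<le> 1" using AE_space by eventually_elim (auto simp: A_def)
    then show ?thesis ..
  next
    case 2
    then have "AE x in M. x \<notin> space M - A" by (intro AE_not_in) (auto simp: null_sets_def)
    then have "AE x in M. 1 \<le> f x" using AE_space by eventually_elim (auto simp: A_def)
    then show ?thesis ..
  qed
  have "(\<integral>\<^sup>+x. f x \<partial>M) = emeasure N (space M)"
    by (subst eN) (auto intro!: nn_integral_cong)
  then have I: "integral\<^sup>N M f = 1" "(\<integral>\<^sup>+x. 1 \<partial>M) = 1"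
    using N.emeasure_space_1 M.emeasure_space_1 sp by simp_all
  \<comment> \<open>The density and the constant 1 have the same integral, so a one-sided bound
    almost everywhere is already an equality.\<close>
  have "AE x in M. f x = 1"
    using fle
  proof
    assume "AE x in M. f x \<le> 1"
    from AE_eq_of_nn_integral_eq[OF f _ this] show ?thesis by (simp add: I M.emeasure_space_1)
  next
    assume "AE x in M. 1 \<le> f x"
    from AE_eq_of_nn_integral_eq[OF _ f this] have "AE x in M. 1 = f x" by (simp add: I M.emeasure_space_1)
    then show ?thesis by eventually_elim simp
  qed
  from density_cong[OF f _ this] have "density M f = density M (\<lambda>_. 1)" by simp
  then show ?thesis using Nf by (simp add: density_1)
qed


section \<open>Translation charts and area\<close>

locale translation_surf =
  fixes \<A> :: "'a::{t2_space,second_countable_topology} chart set" and \<alpha> :: "'a form"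
  assumes surf: "translation_surface \<A> \<alpha>"
begin

abbreviation "tchart \<equiv> translation_chart \<A> \<alpha>"

lemma atlasD:
  assumes "c \<in> \<A>"
  shows "open (fst c)" "open (snd c ` fst c)"
    "homeomorphism (fst c) (snd c ` fst c) (snd c) (inv_into (fst c) (snd c))"
    "inj_on (snd c) (fst c)" "continuous_on (fst c) (snd c)"
    "\<alpha> c holomorphic_on snd c ` fst c"
    "\<And>U. open U \<Longrightarrow> U \<subseteq> fst c \<Longrightarrow> open (snd c ` U)"
proof -
  show *: "open (fst c)" "open (snd c ` fst c)"
    "homeomorphism (fst c) (snd c ` fst c) (snd c) (inv_into (fst c) (snd c))"
    "\<alpha> c holomorphic_on snd c ` fst c"
    using surf assms
    unfolding translation_surface_def riemann_surface_def holomorphic_form_def by blast+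
  show "continuous_on (fst c) (snd c)" using *(3) unfolding homeomorphism_def by blast
  show "inj_on (snd c) (fst c)"
    using *(3) unfolding homeomorphism_def by (metis inj_on_inverseI)
  fix U assume "open U" "U \<subseteq> fst c"
  then show "open (snd c ` U)"
    using homeomorphism_imp_open_map[OF *(3), of U] *(1,2)
    by (metis openin_open_eq)
qed

lemma transition_holomorphic:
  assumes "c \<in> \<A>" "d \<in> \<A>"
  shows "transition c d holomorphic_on overlap c d"
    "z \<in> overlap c d \<Longrightarrow> \<alpha> c z = \<alpha> d (transition c d z) * deriv (transition c d) z"
  using surf assms
  unfolding translation_surface_def riemann_surface_def holomorphic_form_def by blast+

lemma Union_atlas: "(\<Union>c\<in>\<A>. fst c) = UNIV"
  using surf unfolding translation_surface_def riemann_surface_def by blast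

lemma ex_atlas: obtains c where "c \<in> \<A>" "x \<in> fst c"
  using Union_atlas by blast

lemma transition_snd [simp]:
  assumes "c \<in> \<A>" "x \<in> fst c"
  shows "transition c d (snd c x) = snd d x"
  using assms atlasD(4) by (simp add: transition_def)

section \<open>Translation charts as local homeomorphisms, unique up to constants\<close>

lemma tchart_derivative:
  assumes "tchart V \<psi>" "c \<in> \<A>" "x \<in> fst c" "x \<in> V"
  shows "(transition c (V, \<psi>) has_field_derivative \<alpha> c (snd c x)) (at (snd c x))"
  using assms unfolding translation_chart_def overlap_def by auto

lemma tchart_openD: "tchart V \<psi> \<Longrightarrow> open V"
  and tchart_injD: "tchart V \<psi> \<Longrightarrow> inj_on \<psi> V"
  unfolding translation_chart_def by auto

text \<open>Continuity is not demanded of a translation chart; it comes from differentiability of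
  its expression in an atlas coordinate, composed with that continuous coordinate.\<close>

lemma tchart_continuous:
  assumes "tchart V \<psi>"
  shows "continuous_on V \<psi>"
proof -
  have "isCont \<psi> x" if x: "x \<in> V" for x
  proof -
    obtain c where c: "c \<in> \<A>" "x \<in> fst c" by (rule ex_atlas)
    have T: "isCont (transition c (V, \<psi>)) (snd c x)"
      using tchart_derivative[OF assms c x] by (rule DERIV_isCont)
    have "isCont (snd c) x"
      using atlasD[OF c(1)] c(2) by (simp add: continuous_on_eq_continuous_at)
    then have "isCont (\<lambda>y. transition c (V, \<psi>) (snd c y)) x"
      using T by (rule isCont_o2)
    moreover have ev: "\<forall>\<^sub>F y in nhds x. transition c (V, \<psi>) (snd c y) = \<psi> y"
      using eventually_nhds_in_open[OF atlasD(1)[OF c(1)] c(2)]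
      by eventually_elim (simp add: c)
    ultimately show ?thesis using isCont_cong[OF ev] by blast
  qed
  then show ?thesis by (simp add: continuous_at_imp_continuous_on)
qed

text \<open>In each atlas coordinate the chart is an injective continuous map on an open subset of
  the plane, so invariance of domain applies; the pieces are then united over the atlas.\<close>

lemma tchart_open_image:
  assumes t: "tchart V \<psi>" and W: "open W" "W \<subseteq> V"
  shows "open (\<psi> ` W)"
proof -
  have *: "open (\<psi> ` (W \<inter> fst c))" if c: "c \<in> \<A>" for c
  proof -
    let ?T = "transition c (V, \<psi>)"
    let ?W = "W \<inter> fst c"
    have op: "open (snd c ` ?W)" by (rule atlasD(7)[OF c]) (use W atlasD(1)[OF c] in auto)
    have cont: "continuous_on (snd c ` ?W) ?T"
    proof (rule continuous_at_imp_continuous_on, safe)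
      fix x assume "x \<in> W" "x \<in> fst c"
      then show "isCont ?T (snd c x)"
        using tchart_derivative[OF t c, of x] W DERIV_isCont by blast
    qed
    have eq: "?T ` snd c ` ?W = \<psi> ` ?W"
      using c by (force simp: image_iff)
    have inj: "inj_on ?T (snd c ` ?W)"
    proof (rule inj_onI, clarsimp simp: c)
      fix x y assume "x \<in> W" "y \<in> W" "\<psi> x = \<psi> y"
      then show "snd c x = snd c y" using tchart_injD[OF t] W by (metis inj_onD subsetD)
    qed
    show ?thesis using invariance_of_domain[OF cont op inj] eq by simp
  qed
  have "\<psi> ` W = (\<Union>c\<in>\<A>. \<psi> ` (W \<inter> fst c))"
    using Union_atlas by blast
  then show "open (\<psi> ` W)" using * by auto
qed

lemma tchart_homeomorphism:
  assumes t: "tchart V \<psi>"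
  shows "homeomorphism V (\<psi> ` V) \<psi> (inv_into V \<psi>)"
proof -
  note inj = tchart_injD[OF t]
  have "continuous_on (\<psi> ` V) (inv_into V \<psi>)"
  proof (subst continuous_on_open_vimage)
    show "open (\<psi> ` V)" using tchart_open_image[OF t tchart_openD[OF t]] by blast
    show "\<forall>B. open B \<longrightarrow> open (inv_into V \<psi> -` B \<inter> \<psi> ` V)"
    proof safe
      fix B :: "'a set" assume "open B"
      have "inv_into V \<psi> -` B \<inter> \<psi> ` V = \<psi> ` (B \<inter> V)" using inj by (auto simp: image_iff)
      moreover have "open (\<psi> ` (B \<inter> V))"
        by (rule tchart_open_image[OF t]) (use \<open>open B\<close> tchart_openD[OF t] in auto)
      ultimately show "open (inv_into V \<psi> -` B \<inter> \<psi> ` V)" by simp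
    qed
  qed
  then show ?thesis using tchart_continuous[OF t] inj
    unfolding homeomorphism_def by (auto simp: image_image)
qed

lemma tchart_borel_image:
  assumes t: "tchart V \<psi>" and "X \<in> sets borel" "X \<subseteq> V"
  shows "\<psi> ` X \<in> sets borel"
  using homeomorphism_image_borel[OF tchart_homeomorphism[OF t]]
    tchart_open_image[OF t tchart_openD[OF t]] assms(2,3) by auto

text \<open>Both charts are primitives of the same form, so their difference has derivative 0 on a
  coordinate disc. The constant is only local, as \<open>V \<inter> W\<close> may be
  disconnected.\<close>

lemma tchart_diff:
  assumes t: "tchart V \<psi>" "tchart W \<phi>" and x: "x \<in> V" "x \<in> W"
  shows "\<forall>\<^sub>F z in nhds x. \<phi> z - \<psi> z = \<phi> x - \<psi> x"
proof -
  obtain c where c: "c \<in> \<A>" "x \<in> fst c" by (rule ex_atlas)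
  let ?U = "V \<inter> W \<inter> fst c"
  have U: "open ?U" using t[THEN tchart_openD] atlasD(1)[OF c(1)] by auto
  have "open (snd c ` ?U)" by (rule atlasD(7)[OF c(1) U]) auto
  then obtain r where r: "r > 0" "ball (snd c x) r \<subseteq> snd c ` ?U"
    using x c by (meson IntI imageI openE)
  let ?h = "\<lambda>z. transition c (W, \<phi>) z - transition c (V, \<psi>) z"
  have "\<exists>k. \<forall>z\<in>ball (snd c x) r. ?h z = k"
  proof (rule has_field_derivative_zero_constant)
    fix z assume "z \<in> ball (snd c x) r"
    then obtain y where y: "y \<in> ?U" "z = snd c y" using r by blast
    have "(?h has_field_derivative (\<alpha> c z - \<alpha> c z)) (at z)"
      unfolding y(2) using y(1) by (intro DERIV_diff tchart_derivative t c) auto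
    then show "(?h has_field_derivative 0) (at z within ball (snd c x) r)"
      by (simp add: has_field_derivative_at_within)
  qed auto
  then obtain k where k: "\<And>z. z \<in> ball (snd c x) r \<Longrightarrow> ?h z = k" by blast
  have "isCont (snd c) x"
    using atlasD[OF c(1)] c(2) by (simp add: continuous_on_eq_continuous_at)
  then have "\<forall>\<^sub>F z in nhds x. snd c z \<in> ball (snd c x) r"
    using r(1) by (intro topological_tendstoD) (auto simp: continuous_at_imp_continuous_at_within isCont_def tendsto_nhds_iff)
  moreover have "\<forall>\<^sub>F z in nhds x. z \<in> fst c"
    using c atlasD(1) by (intro eventually_nhds_in_open) auto
  ultimately show ?thesis
  proof eventually_elim
    case (elim z)
    then show ?case using k[of "snd c z"] k[of "snd c x"] r(1) c by simp
  qed
qed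

text \<open>The derivative of an injective holomorphic function never vanishes, and here that
  derivative is the coefficient of the form.\<close>

lemma tchart_nonzero:
  assumes t: "tchart V \<psi>" and x: "x \<in> V"
  shows "x \<notin> form_zeros \<A> \<alpha>"
proof
  assume "x \<in> form_zeros \<A> \<alpha>"
  then obtain c where c: "c \<in> \<A>" "x \<in> fst c" "\<alpha> c (snd c x) = 0"
    unfolding form_zeros_def by auto
  let ?T = "transition c (V, \<psi>)"
  have W: "open (V \<inter> fst c)" using tchart_openD[OF t] atlasD(1)[OF c(1)] by auto
  have op: "open (snd c ` (V \<inter> fst c))"
    by (rule atlasD(7)[OF c(1) W]) auto
  have "inj_on ?T (snd c ` (V \<inter> fst c))"
    using inj_onD[OF tchart_injD[OF t]] by (intro inj_onI) (clarsimp simp: c, metis)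
  moreover have "?T holomorphic_on snd c ` (V \<inter> fst c)"
    unfolding holomorphic_on_open[OF op] using tchart_derivative[OF t c(1)] by blast
  ultimately have "deriv ?T (snd c x) \<noteq> 0"
    using holomorphic_injective_imp_regular[OF _ op] x c by blast
  then show False using DERIV_imp_deriv[OF tchart_derivative[OF t c(1,2) x]] c(3) by simp
qed

text \<open>The form has a primitive on a coordinate disc; its derivative at the centre is nonzero,
  so it is injective on a smaller disc.\<close>

lemma ex_tchart:
  assumes x: "x \<notin> form_zeros \<A> \<alpha>"
  obtains V \<psi> where "tchart V \<psi>" "x \<in> V"
proof -
  obtain c where c: "c \<in> \<A>" "x \<in> fst c" by (rule ex_atlas)
  let ?z = "snd c x"
  have nz: "\<alpha> c ?z \<noteq> 0" using x c unfolding form_zeros_def by auto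
  obtain r where r: "r > 0" "ball ?z r \<subseteq> snd c ` fst c"
    using atlasD(2)[OF c(1)] c(2) by (meson imageI openE)
  have "\<alpha> c holomorphic_on ball ?z r"
    using atlasD(6)[OF c(1)] r(2) by (rule holomorphic_on_subset)
  then obtain h where "\<And>z. z \<in> ball ?z r \<Longrightarrow> (h has_field_derivative \<alpha> c z) (at z within ball ?z r)"
    using holomorphic_convex_primitive'[of "ball ?z r" "\<alpha> c"] by auto
  then have h: "(h has_field_derivative \<alpha> c z) (at z)" if "z \<in> ball ?z r" for z
    using that by (metis at_within_open open_ball)
  have "h holomorphic_on ball ?z r" 
    unfolding holomorphic_on_open[OF open_ball] using h by blast
  moreover have "deriv h ?z \<noteq> 0" using nz r DERIV_imp_deriv[OF h] by simp
  ultimately obtain s where s: "s > 0" "ball ?z s \<subseteq> ball ?z r" "inj_on h (ball ?z s)"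
    using r(1) by (meson centre_in_ball has_complex_derivative_locally_injective open_ball)
  define V where "V = fst c \<inter> snd c -` ball ?z s"
  have V: "open V"
    unfolding V_def using atlasD(1,5)[OF c(1)] by (metis Int_commute continuous_on_open_vimage open_ball)
  have "tchart V (h \<circ> snd c)"
    unfolding translation_chart_def
  proof (intro conjI ballI)
    show "inj_on (h \<circ> snd c) V"
      using s(3) atlasD(4)[OF c(1)] unfolding V_def inj_on_def by auto
    \<comment> \<open>The derivative must be right in every atlas chart \<open>d\<close>, not only
      in \<open>c\<close>: the chain rule and the transformation law of the form carry it
      over.\<close>
    fix d z assume d: "d \<in> \<A>" and "z \<in> overlap d (V, h \<circ> snd c)"
    then obtain y where y: "y \<in> fst d" "y \<in> V" "z = snd d y" unfolding overlap_def by auto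
    have yc: "y \<in> fst c" using y(2) unfolding V_def by auto
    have zo: "z \<in> overlap d c" using y yc unfolding overlap_def by auto
    have opo: "open (overlap d c)"
      unfolding overlap_def by (rule atlasD(7)[OF d]) (use atlasD(1)[OF c(1)] atlasD(1)[OF d] in auto)
    have D1: "(transition d c has_field_derivative deriv (transition d c) z) (at z)"
      using transition_holomorphic(1)[OF d c(1)] opo zo by (rule holomorphic_derivI)
    have "snd c y \<in> ball ?z r" using y s(2) unfolding V_def by auto
    then have D2: "(h has_field_derivative \<alpha> c (transition d c z)) (at (transition d c z))"
      using h y d by simp
    have "(h \<circ> transition d c has_field_derivative \<alpha> d z) (at z)"
      using DERIV_chain[OF D2 D1] transition_holomorphic(2)[OF d c(1) zo] by simp
    then show "(transition d (V, h \<circ> snd c) has_field_derivative \<alpha> d z) (at z)"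
      by (simp add: transition_def comp_assoc)
  qed (rule V)
  moreover have "x \<in> V" using c s(1) unfolding V_def by auto
  ultimately show thesis by (rule that)
qed

text \<open>Describing the zeros as the points outside all translation charts makes the set visibly
  closed, hence Borel.\<close>

lemma zeros_eq: "form_zeros \<A> \<alpha> = - \<Union>{V. \<exists>\<psi>. tchart V \<psi>}"
  using tchart_nonzero ex_tchart by blast

lemma closed_zeros: "closed (form_zeros \<A> \<alpha>)"
  unfolding zeros_eq closed_def using tchart_openD by auto

text \<open>This makes area independent of the chart. The change of charts is a translation only
  locally, with a constant that may vary over \<open>X\<close>, hence the passage through
  \<open>image_measure_preserving_local\<close>.\<close>

lemma tchart_image_measure:
  assumes t: "tchart V \<psi>" "tchart W \<phi>" and X: "X \<in> sets borel" "X \<subseteq> V" "X \<subseteq> W"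
  shows "emeasure lborel (\<psi> ` X) = emeasure lborel (\<phi> ` X)"
proof -
  note h = tchart_homeomorphism[OF t(1)]
  let ?i = "inv_into V \<psi>"
  define g where "g = \<phi> \<circ> ?i"
  have gp: "g (\<psi> x) = \<phi> x" if "x \<in> X" for x
    using that X(2) tchart_injD[OF t(1)] unfolding g_def by auto
  then have gX: "g ` \<psi> ` X = \<phi> ` X" by (force simp: image_iff)
  have "emeasure lborel (g ` \<psi> ` X) = emeasure lborel (\<psi> ` X)"
  proof (rule image_measure_preserving_local)
    show "\<psi> ` X \<in> sets borel" using tchart_borel_image t(1) X(1,2) by blast
    show "inj_on g (\<psi> ` X)"
    proof (rule inj_onI, clarify)
      fix x y assume "x \<in> X" "y \<in> X" "g (\<psi> x) = g (\<psi> y)"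
      then have "x = y" using gp tchart_injD[OF t(2)] X(3) by (metis inj_onD subsetD)
      then show "\<psi> x = \<psi> y" by simp
    qed
    fix z assume "z \<in> \<psi> ` X"
    then obtain x where x: "x \<in> X" "z = \<psi> x" by auto
    then have "x \<in> V" "x \<in> W" using X by auto
    from tchart_diff[OF t this] obtain U where U: "open U" "x \<in> U"
      "\<And>y. y \<in> U \<Longrightarrow> \<phi> y - \<psi> y = \<phi> x - \<psi> x"
      unfolding eventually_nhds by blast
    show "\<exists>U. open U \<and> z \<in> U \<and> (\<forall>Y\<in>sets borel. Y \<subseteq> U \<inter> \<psi> ` X \<longrightarrow>
       g ` Y \<in> sets lborel \<and> emeasure lborel (g ` Y) = emeasure lborel Y)"
    proof (intro exI conjI ballI impI)
      show "open (\<psi> ` (U \<inter> V))"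
        by (rule tchart_open_image[OF t(1)]) (use U(1) tchart_openD[OF t(1)] in auto)
      show "z \<in> \<psi> ` (U \<inter> V)" using x X U by auto
      fix Y assume Y: "Y \<in> sets borel" "Y \<subseteq> \<psi> ` (U \<inter> V) \<inter> \<psi> ` X"
      have "g y = y + (\<phi> x - \<psi> x)" if yY: "y \<in> Y" for y
      proof -
        obtain w where "w \<in> U" "w \<in> V" "y = \<psi> w" using yY Y(2) by blast
        then show ?thesis using U(3)[of w] tchart_injD[OF t(1)]
          unfolding g_def by (simp add: algebra_simps)
      qed
      then have "g ` Y = (\<lambda>y. y + (\<phi> x - \<psi> x)) ` Y" by auto
      then show "g ` Y \<in> sets lborel" "emeasure lborel (g ` Y) = emeasure lborel Y"
        using emeasure_lborel_translate[OF Y(1)] by auto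
    qed
  qed simp
  then show ?thesis using gX by simp
qed

section \<open>Construction and uniqueness of the area measure\<close>

lemma tchart_cover:
  obtains V \<psi> where "\<And>n::nat. tchart (V n) (\<psi> n)" "- form_zeros \<A> \<alpha> = (\<Union>n. V n)"
proof -
  have *: "\<exists>U. open U \<and> x \<in> U \<and> (\<exists>\<psi>. tchart U \<psi>)" if "x \<in> - form_zeros \<A> \<alpha>" for x
    using ex_tchart[of x] that tchart_openD by (metis ComplD)
  have "tchart {} \<psi>" for \<psi>
    unfolding translation_chart_def overlap_def by auto
  then have **: "\<exists>\<psi>. tchart {} \<psi>" by blast
  obtain U :: "nat \<Rightarrow> 'a set" where U: "\<And>n. \<exists>\<psi>. tchart (U n) \<psi>" "- form_zeros \<A> \<alpha> \<subseteq> (\<Union>n. U n)"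
    using countable_open_cover[of "- form_zeros \<A> \<alpha>" "\<lambda>U. \<exists>\<psi>. tchart U \<psi>", OF * **] by metis
  obtain \<psi> where \<psi>: "\<And>n. tchart (U n) (\<psi> n)" using U(1) by metis
  have "(\<Union>n. U n) \<subseteq> - form_zeros \<A> \<alpha>" using tchart_nonzero[OF \<psi>] by blast
  then show thesis using U(2) by (intro that[of U \<psi>] \<psi>) (rule subset_antisym)
qed

text \<open>Disjointness permits area to be written as a sum over the pieces without counting
  overlaps twice; the price is that the pieces are Borel rather than open.\<close>

lemma tchart_pieces:
  obtains V \<psi> D where "\<And>n::nat. tchart (V n) (\<psi> n)" "\<And>n. D n \<in> sets borel" "\<And>n. D n \<subseteq> V n"
    "disjoint_family D" "- form_zeros \<A> \<alpha> = (\<Union>n. D n)"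
proof -
  obtain V \<psi> where V: "\<And>n::nat. tchart (V n) (\<psi> n)" "- form_zeros \<A> \<alpha> = (\<Union>n. V n)"
    by (rule tchart_cover) blast
  have "range V \<subseteq> sets borel" using tchart_openD[OF V(1)] by auto
  then have "range (disjointed V) \<subseteq> sets borel" by (rule sets.range_disjointed_sets)
  then show thesis
    using V by (intro that[of V \<psi> "disjointed V"])
      (auto simp: disjointed_subset disjoint_family_disjointed UN_disjointed_eq)
qed

text \<open>Planar Lebesgue measure is transported to each piece through its own chart. Agreement
  with all other charts then follows from \<open>tchart_image_measure\<close>.\<close>

lemma ex_area_measure: "\<exists>M. is_area_measure \<A> \<alpha> M"
proof -
  obtain V \<psi> D where D: "\<And>n::nat. tchart (V n) (\<psi> n)" "\<And>n. D n \<in> sets borel" "\<And>n. D n \<subseteq> V n"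
    "disjoint_family D" "- form_zeros \<A> \<alpha> = (\<Union>n. D n)"
    by (rule tchart_pieces) blast
  define \<mu> where "\<mu> X = (\<Sum>n. emeasure lborel (\<psi> n ` (X \<inter> D n)))" for X
  define M where "M = measure_of UNIV (sets borel) \<mu>"
  have b: "\<psi> n ` (X \<inter> D n) \<in> sets borel" if "X \<in> sets borel" for n X
    by (rule tchart_borel_image[OF D(1)]) (use D(2,3) that in auto)
  have "countably_additive (sets borel) \<mu>"
  proof (rule countably_additiveI)
    fix X :: "nat \<Rightarrow> 'a set"
    assume X: "range X \<subseteq> sets borel" "disjoint_family X"
    have "(\<Sum>i. emeasure lborel (\<psi> n ` (X i \<inter> D n))) =
        emeasure lborel (\<psi> n ` ((\<Union>i. X i) \<inter> D n))" for n
    proof -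
      have "disjoint_family (\<lambda>i. \<psi> n ` (X i \<inter> D n))"
        unfolding disjoint_family_on_def
      proof safe
        fix i j x y assume "i \<noteq> j" "x \<in> X i" "y \<in> X j" "\<psi> n x = \<psi> n y" "x \<in> D n" "y \<in> D n"
        then have "x = y" using tchart_injD[OF D(1), of n] D(3)[of n] by (meson inj_onD subsetD)
        then show "\<psi> n x \<in> {}" using X(2) \<open>i \<noteq> j\<close> \<open>x \<in> X i\<close> \<open>y \<in> X j\<close>
          unfolding disjoint_family_on_def by blast
      qed
      then have "(\<Sum>i. emeasure lborel (\<psi> n ` (X i \<inter> D n))) =
          emeasure lborel (\<Union>i. \<psi> n ` (X i \<inter> D n))"
        using b X(1) by (intro suminf_emeasure) auto
      also have "(\<Union>i. \<psi> n ` (X i \<inter> D n)) = \<psi> n ` ((\<Union>i. X i) \<inter> D n)" by blast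
      finally show ?thesis .
    qed
    then show "(\<Sum>i. \<mu> (X i)) = \<mu> (\<Union>i. X i)"
      unfolding \<mu>_def by (subst suminf_swap_ennreal) simp
  qed
  moreover have "positive (sets borel) \<mu>" unfolding positive_def \<mu>_def by simp
  ultimately have em: "emeasure M X = \<mu> X" if "X \<in> sets borel" for X
    unfolding M_def using that sets.sigma_algebra_axioms[of "borel :: 'a measure"]
    by (intro emeasure_measure_of_sigma) auto
  have "is_area_measure \<A> \<alpha> M"
    unfolding is_area_measure_def
  proof (intro conjI allI impI)
    show sM: "sets M = sets borel"
      unfolding M_def using sets.sigma_sets_eq[of "borel :: 'a measure"]
      by (subst sets_measure_of) auto
    have "form_zeros \<A> \<alpha> \<inter> D n = {}" for n using D(5) by blast
    then have "\<mu> (form_zeros \<A> \<alpha>) = 0" unfolding \<mu>_def by simp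
    then show "emeasure M (form_zeros \<A> \<alpha>) = 0" using em closed_zeros by auto
    fix W \<phi> and X :: "'a set" assume A: "tchart W \<phi> \<and> X \<in> sets borel \<and> X \<subseteq> W"
    \<comment> \<open>A set inside a chart avoids the zeros, so the pieces exhaust it and no mass is
      lost.\<close>
    have inD: "X \<subseteq> (\<Union>n. D n)" using A tchart_nonzero[of W \<phi>] D(5) by blast
    have "emeasure lborel (\<psi> n ` (X \<inter> D n)) = emeasure lborel (\<phi> ` (X \<inter> D n))" for n
      by (rule tchart_image_measure) (use A D in auto)
    then have "\<mu> X = (\<Sum>n. emeasure lborel (\<phi> ` (X \<inter> D n)))" unfolding \<mu>_def by simp
    also have "\<dots> = emeasure lborel (\<Union>n. \<phi> ` (X \<inter> D n))"
    proof (rule suminf_emeasure)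
      show "range (\<lambda>n. \<phi> ` (X \<inter> D n)) \<subseteq> sets lborel"
        using A D(2) by (auto intro!: tchart_borel_image[of W \<phi>])
      show "disjoint_family (\<lambda>n. \<phi> ` (X \<inter> D n))"
        unfolding disjoint_family_on_def
      proof safe
        fix i j x y assume "i \<noteq> j" "x \<in> D i" "y \<in> D j" "\<phi> x = \<phi> y" "x \<in> X" "y \<in> X"
        then have "x = y" using tchart_injD[of W \<phi>] A by (meson inj_onD subsetD)
        then show "\<phi> x \<in> {}" using D(4) \<open>i \<noteq> j\<close> \<open>x \<in> D i\<close> \<open>y \<in> D j\<close>
          unfolding disjoint_family_on_def by blast
      qed
    qed
    also have "(\<Union>n. \<phi> ` (X \<inter> D n)) = \<phi> ` X" using inD by blast
    finally show "emeasure M X = emeasure lborel (\<phi> ` X)" using em A by simp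
  qed
  then show ?thesis by blast
qed

text \<open>Once the null set of zeros is removed, every Borel set splits into charted pieces, on
  which the definition prescribes the value.\<close>

lemma area_measure_unique:
  assumes "is_area_measure \<A> \<alpha> M" "is_area_measure \<A> \<alpha> N"
  shows "M = N"
proof (rule measure_eqI)
  obtain V \<psi> D where D: "\<And>n::nat. tchart (V n) (\<psi> n)" "\<And>n. D n \<in> sets borel" "\<And>n. D n \<subseteq> V n"
    "disjoint_family D" "- form_zeros \<A> \<alpha> = (\<Union>n. D n)"
    by (rule tchart_pieces) blast
  show "sets M = sets N" using assms unfolding is_area_measure_def by simp
  have *: "emeasure K X = (\<Sum>n. emeasure lborel (\<psi> n ` (X \<inter> D n)))"
    if K: "is_area_measure \<A> \<alpha> K" and X: "X \<in> sets borel" for K X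
  proof -
    have sK: "sets K = sets borel" using K unfolding is_area_measure_def by simp
    have "form_zeros \<A> \<alpha> \<in> null_sets K"
      using K closed_zeros unfolding is_area_measure_def by (auto simp: null_sets_def)
    then have "emeasure K X = emeasure K (X - form_zeros \<A> \<alpha>)"
      using X sK by (metis emeasure_Diff_null_set)
    also have "X - form_zeros \<A> \<alpha> = (\<Union>n. X \<inter> D n)" using D(5) by blast
    also have "emeasure K (\<Union>n. X \<inter> D n) = (\<Sum>n. emeasure K (X \<inter> D n))"
      using D(4) by (intro suminf_emeasure[symmetric]) (use X D(2) sK in \<open>auto simp: disjoint_family_on_def\<close>)
    also have "\<dots> = (\<Sum>n. emeasure lborel (\<psi> n ` (X \<inter> D n)))"
    proof (rule suminf_cong)
      fix n
      have "X \<inter> D n \<in> sets borel" "X \<inter> D n \<subseteq> V n" using X D(2,3) by auto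
      then show "emeasure K (X \<inter> D n) = emeasure lborel (\<psi> n ` (X \<inter> D n))"
        using K D(1) unfolding is_area_measure_def by blast
    qed
    finally show ?thesis .
  qed
  fix X assume "X \<in> sets M"
  then have "X \<in> sets borel" using assms unfolding is_area_measure_def by simp
  then show "emeasure M X = emeasure N X" using * assms by simp
qed

abbreviation "area \<equiv> area_measure \<A> \<alpha>"

lemma is_area_measure: "is_area_measure \<A> \<alpha> area"
  unfolding area_measure_def
  using theI'[of "is_area_measure \<A> \<alpha>"] ex_area_measure area_measure_unique by blast

lemma sets_area [simp, measurable_cong]: "sets area = sets borel"
  using is_area_measure unfolding is_area_measure_def by simp

lemma space_area [simp]: "space area = UNIV"
  using sets_eq_imp_space_eq[OF sets_area] by simp

lemma emeasure_area_tchart: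
  "tchart V \<psi> \<Longrightarrow> X \<in> sets borel \<Longrightarrow> X \<subseteq> V \<Longrightarrow> emeasure area X = emeasure lborel (\<psi> ` X)"
  using is_area_measure unfolding is_area_measure_def by blast

lemma zeros_null: "form_zeros \<A> \<alpha> \<in> null_sets area"
  using is_area_measure closed_zeros unfolding is_area_measure_def by (auto simp: null_sets_def)


section \<open>The flow\<close>

text \<open>Arbitrary time sets, unlike in \<^const>\<open>trajectory\<close>, so that curves can be shifted and glued.\<close>

definition flowline :: "real set \<Rightarrow> (real \<Rightarrow> 'a) \<Rightarrow> bool" where
  "flowline I \<gamma> \<longleftrightarrow> (\<forall>s\<in>I. \<exists>V \<psi>. tchart V \<psi> \<and> \<gamma> s \<in> V \<and>
     (\<exists>e>0. \<forall>r\<in>I. dist r s < e \<longrightarrow> \<gamma> r \<in> V \<and> \<psi> (\<gamma> r) = \<psi> (\<gamma> s) + of_real (r - s)))"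

text \<open>The filter \<open>at s within I\<close> omits \<open>s\<close> itself, but at
  \<open>r = s\<close> the condition holds trivially; so it may be read as a metric condition
  including \<open>s\<close>.\<close>

lemma trajectory_iff_flowline: "trajectory \<A> \<alpha> t \<gamma> \<longleftrightarrow> flowline (closed_segment 0 t) \<gamma>"
proof -
  have *: "(\<forall>\<^sub>F r in at s within I. \<gamma> r \<in> V \<and> \<psi> (\<gamma> r) = \<psi> (\<gamma> s) + of_real (r - s)) \<longleftrightarrow>
    (\<exists>e>0. \<forall>r\<in>I. dist r s < e \<longrightarrow> \<gamma> r \<in> V \<and> \<psi> (\<gamma> r) = \<psi> (\<gamma> s) + of_real (r - s))"
    if "\<gamma> s \<in> V" for s :: real and V I and \<psi> :: "'a \<Rightarrow> complex"
  proof -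
    have "(\<forall>r\<in>I. r \<noteq> s \<and> dist r s < e \<longrightarrow> \<gamma> r \<in> V \<and> \<psi> (\<gamma> r) = \<psi> (\<gamma> s) + of_real (r - s)) \<longleftrightarrow>
      (\<forall>r\<in>I. dist r s < e \<longrightarrow> \<gamma> r \<in> V \<and> \<psi> (\<gamma> r) = \<psi> (\<gamma> s) + of_real (r - s))" for e
      using that by (intro ball_cong) auto
    then show ?thesis unfolding eventually_at by simp
  qed
  show ?thesis
    unfolding trajectory_def flowline_def by (intro ball_cong ex_cong1 conj_cong refl *)
qed

section \<open>Flow curves: continuity, gluing, uniqueness\<close>

lemma flowlineE:
  assumes "flowline I \<gamma>" "s \<in> I"
  obtains V \<psi> e where "tchart V \<psi>" "\<gamma> s \<in> V" "e > 0"
    "\<And>r. r \<in> I \<Longrightarrow> dist r s < e \<Longrightarrow> \<gamma> r \<in> V \<and> \<psi> (\<gamma> r) = \<psi> (\<gamma> s) + of_real (r - s)"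
  using assms unfolding flowline_def by blast

lemma inv_tchart:
  assumes "tchart V \<psi>" "z \<in> \<psi> ` V"
  shows "isCont (inv_into V \<psi>) z" "inv_into V \<psi> z \<in> V" "\<psi> (inv_into V \<psi> z) = z"
proof -
  have "open (\<psi> ` V)" using tchart_open_image[OF assms(1) tchart_openD[OF assms(1)]] by blast
  moreover have "continuous_on (\<psi> ` V) (inv_into V \<psi>)"
    using tchart_homeomorphism[OF assms(1)] unfolding homeomorphism_def by blast
  ultimately show "isCont (inv_into V \<psi>) z"
    using assms(2) continuous_on_eq_continuous_at by blast
  show "inv_into V \<psi> z \<in> V" "\<psi> (inv_into V \<psi> z) = z"
    using assms(2) by (auto intro: inv_into_into f_inv_into_f)
qed

lemma inv_tchart_eq [simp]: "tchart V \<psi> \<Longrightarrow> x \<in> V \<Longrightarrow> inv_into V \<psi> (\<psi> x) = x"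
  using tchart_injD by auto

text \<open>Near \<open>s\<close> the curve is the continuous inverse chart applied to an affine
  function of time.\<close>

lemma flowline_tendsto:
  assumes "flowline I \<gamma>" "s \<in> I"
  shows "(\<gamma> \<longlongrightarrow> \<gamma> s) (at s within I)"
proof -
  obtain V \<psi> e where V: "tchart V \<psi>" "\<gamma> s \<in> V" "e > 0"
    "\<And>r. r \<in> I \<Longrightarrow> dist r s < e \<Longrightarrow> \<gamma> r \<in> V \<and> \<psi> (\<gamma> r) = \<psi> (\<gamma> s) + of_real (r - s)"
    by (rule flowlineE[OF assms]) blast
  have "((\<lambda>r. \<psi> (\<gamma> s) + of_real (r - s)) \<longlongrightarrow> \<psi> (\<gamma> s) + of_real (s - s)) (at s within I)"
    by (intro tendsto_intros)
  then have lim: "((\<lambda>r. \<psi> (\<gamma> s) + of_real (r - s)) \<longlongrightarrow> \<psi> (\<gamma> s)) (at s within I)" by simp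
  have "isCont (inv_into V \<psi>) (\<psi> (\<gamma> s))" using inv_tchart(1)[OF V(1)] V(2) by blast
  from isCont_tendsto_compose[OF this lim]
  have T: "((\<lambda>r. inv_into V \<psi> (\<psi> (\<gamma> s) + of_real (r - s))) \<longlongrightarrow> inv_into V \<psi> (\<psi> (\<gamma> s))) (at s within I)" .
  have ev: "\<forall>\<^sub>F r in at s within I. inv_into V \<psi> (\<psi> (\<gamma> s) + of_real (r - s)) = \<gamma> r"
    unfolding eventually_at
  proof (intro exI[of _ e] conjI ballI impI V(3))
    fix r assume "r \<in> I" "r \<noteq> s \<and> dist r s < e"
    then have "\<gamma> r \<in> V" "\<psi> (\<gamma> s) + of_real (r - s) = \<psi> (\<gamma> r)" using V(4)[of r] by auto
    then show "inv_into V \<psi> (\<psi> (\<gamma> s) + of_real (r - s)) = \<gamma> r"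
      by (simp only: inv_tchart_eq[OF V(1)])
  qed
  show ?thesis using Lim_transform_eventually[OF T ev] inv_tchart_eq[OF V(1,2)] by simp
qed

text \<open>The definition provides some chart at each time; this allows any prescribed chart
  instead. Continuity brings the curve into \<open>W\<close>, and there the two charts differ by a
  constant.\<close>

lemma flowline_in_tchart:
  assumes g: "flowline I \<gamma>" "s \<in> I" and W: "tchart W \<phi>" "\<gamma> s \<in> W"
  shows "\<exists>e>0. \<forall>r\<in>I. dist r s < e \<longrightarrow> \<gamma> r \<in> W \<and> \<phi> (\<gamma> r) = \<phi> (\<gamma> s) + of_real (r - s)"
proof -
  obtain V \<psi> e where V: "tchart V \<psi>" "\<gamma> s \<in> V" "e > 0"
    "\<And>r. r \<in> I \<Longrightarrow> dist r s < e \<Longrightarrow> \<gamma> r \<in> V \<and> \<psi> (\<gamma> r) = \<psi> (\<gamma> s) + of_real (r - s)"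
    by (rule flowlineE[OF g]) blast
  have "\<forall>\<^sub>F z in nhds (\<gamma> s). z \<in> W \<and> \<phi> z - \<psi> z = \<phi> (\<gamma> s) - \<psi> (\<gamma> s)"
    using tchart_diff[OF V(1) W(1) V(2) W(2)] eventually_nhds_in_open[OF tchart_openD[OF W(1)] W(2)]
    by eventually_elim simp
  then have "\<forall>\<^sub>F r in at s within I. \<gamma> r \<in> W \<and> \<phi> (\<gamma> r) - \<psi> (\<gamma> r) = \<phi> (\<gamma> s) - \<psi> (\<gamma> s)"
    using flowline_tendsto[OF g] by (rule eventually_compose_filterlim)
  then obtain d where d: "d > 0" "\<And>r. r \<in> I \<Longrightarrow> r \<noteq> s \<Longrightarrow> dist r s < d \<Longrightarrow>
      \<gamma> r \<in> W \<and> \<phi> (\<gamma> r) - \<psi> (\<gamma> r) = \<phi> (\<gamma> s) - \<psi> (\<gamma> s)"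
    unfolding eventually_at by blast
  show ?thesis
  proof (intro exI[of _ "min d e"] conjI ballI impI)
    show "min d e > 0" using d V(3) by simp
    fix r assume r: "r \<in> I" "dist r s < min d e"
    then show "\<gamma> r \<in> W" using d(2)[of r] W(2) by (cases "r = s") auto
    show "\<phi> (\<gamma> r) = \<phi> (\<gamma> s) + of_real (r - s)"
      using d(2)[of r] V(4)[of r] r by (cases "r = s") (auto simp: algebra_simps)
  qed
qed

lemma flowline_subset: "flowline I \<gamma> \<Longrightarrow> J \<subseteq> I \<Longrightarrow> flowline J \<gamma>"
  unfolding flowline_def by (meson subsetD)

lemma flowline_cong: "flowline I \<gamma> \<Longrightarrow> (\<And>s. s \<in> I \<Longrightarrow> \<eta> s = \<gamma> s) \<Longrightarrow> flowline I \<eta>"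
  unfolding flowline_def by simp

lemma flowline_shift:
  assumes "flowline I \<gamma>"
  shows "flowline ((+) a ` I) (\<lambda>s. \<gamma> (s - a))"
  unfolding flowline_def
proof clarsimp
  fix s assume "s \<in> I"
  then obtain V \<psi> e where V: "tchart V \<psi>" "\<gamma> s \<in> V" "e > 0"
    "\<And>r. r \<in> I \<Longrightarrow> dist r s < e \<Longrightarrow> \<gamma> r \<in> V \<and> \<psi> (\<gamma> r) = \<psi> (\<gamma> s) + of_real (r - s)"
    by (rule flowlineE[OF assms]) blast
  then show "\<exists>V \<psi>. tchart V \<psi> \<and> \<gamma> s \<in> V \<and> (\<exists>e>0. \<forall>r\<in>I. dist r s < e \<longrightarrow>
      \<gamma> r \<in> V \<and> \<psi> (\<gamma> r) = \<psi> (\<gamma> s) + (of_real r - of_real s))"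
    by (intro exI[of _ V] exI[of _ \<psi>] exI[of _ e] conjI) auto
qed

text \<open>One chart at \<open>s\<close> serves both time sets by
  \<open>flowline_in_tchart\<close>. If \<open>s\<close> lies outside one of them, closedness keeps
  nearby times outside as well, and the condition there is vacuous.\<close>

lemma flowline_Un:
  assumes "flowline I \<gamma>" "flowline J \<gamma>" "closed I" "closed J"
  shows "flowline (I \<union> J) \<gamma>"
  unfolding flowline_def
proof
  fix s assume s: "s \<in> I \<union> J"
  then obtain V \<psi> where V: "tchart V \<psi>" "\<gamma> s \<in> V"
    using assms(1,2) unfolding flowline_def by blast
  have *: "\<exists>e>0. \<forall>r\<in>K. dist r s < e \<longrightarrow> \<gamma> r \<in> V \<and> \<psi> (\<gamma> r) = \<psi> (\<gamma> s) + of_real (r - s)"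
    if K: "flowline K \<gamma>" "closed K" for K
  proof (cases "s \<in> K")
    case True
    then show ?thesis using flowline_in_tchart[OF K(1) _ V] by blast
  next
    case False
    then obtain e where e: "e > 0" "ball s e \<subseteq> - K"
      using K(2) by (meson ComplI open_Compl openE)
    have "\<not> dist r s < e" if "r \<in> K" for r
      using that e(2) by (metis ComplD dist_commute mem_ball subsetD)
    then show ?thesis using e(1) by blast
  qed
  obtain d e where "d > 0" "e > 0" and
    "\<forall>r\<in>I. dist r s < d \<longrightarrow> \<gamma> r \<in> V \<and> \<psi> (\<gamma> r) = \<psi> (\<gamma> s) + of_real (r - s)"
    "\<forall>r\<in>J. dist r s < e \<longrightarrow> \<gamma> r \<in> V \<and> \<psi> (\<gamma> r) = \<psi> (\<gamma> s) + of_real (r - s)"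
    using *[OF assms(1,3)] *[OF assms(2,4)] by blast
  then have "\<exists>e>0. \<forall>r\<in>I \<union> J. dist r s < e \<longrightarrow> \<gamma> r \<in> V \<and> \<psi> (\<gamma> r) = \<psi> (\<gamma> s) + of_real (r - s)"
    by (intro exI[of _ "min d e"]) auto
  then show "\<exists>V \<psi>. tchart V \<psi> \<and> \<gamma> s \<in> V \<and> (\<exists>e>0. \<forall>r\<in>I \<union> J. dist r s < e \<longrightarrow>
      \<gamma> r \<in> V \<and> \<psi> (\<gamma> r) = \<psi> (\<gamma> s) + of_real (r - s))"
    using V by blast
qed

text \<open>The times of agreement are open in \<open>I\<close> because charts are injective, and
  closed because the surface is Hausdorff; \<open>I\<close> is connected.\<close>

lemma flowline_unique:
  assumes g: "flowline I \<gamma>" and d: "flowline I \<delta>" and I: "connected I"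
    and a: "a \<in> I" "\<gamma> a = \<delta> a" and b: "b \<in> I"
  shows "\<gamma> b = \<delta> b"
proof (rule connected_induction_simple[where P = "\<lambda>s. \<gamma> s = \<delta> s", OF I a(1) b a(2)])
  fix s assume s: "s \<in> I"
  show "\<exists>T. openin (top_of_set I) T \<and> s \<in> T \<and> (\<forall>x\<in>T. \<forall>y\<in>T. \<gamma> x = \<delta> x \<longrightarrow> \<gamma> y = \<delta> y)"
  proof (cases "\<gamma> s = \<delta> s")
    case True
    obtain V \<psi> e where V: "tchart V \<psi>" "\<gamma> s \<in> V" "e > 0"
      "\<And>r. r \<in> I \<Longrightarrow> dist r s < e \<Longrightarrow> \<gamma> r \<in> V \<and> \<psi> (\<gamma> r) = \<psi> (\<gamma> s) + of_real (r - s)"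
      by (rule flowlineE[OF g s]) blast
    obtain e' where e': "e' > 0"
      "\<And>r. r \<in> I \<Longrightarrow> dist r s < e' \<Longrightarrow> \<delta> r \<in> V \<and> \<psi> (\<delta> r) = \<psi> (\<delta> s) + of_real (r - s)"
      using flowline_in_tchart[OF d s V(1)] V(2) True by auto
    have "\<gamma> r = \<delta> r" if "r \<in> I \<inter> ball s (min e e')" for r
      using V(4)[of r] e'(2)[of r] that True inj_onD[OF tchart_injD[OF V(1)], of "\<gamma> r" "\<delta> r"]
      by (simp add: dist_commute)
    then show ?thesis using s V(3) e'(1)
      by (intro exI[of _ "I \<inter> ball s (min e e')"]) (auto intro: openin_open_Int)
  next
    case False
    obtain U U' where U: "open U" "open U'" "\<gamma> s \<in> U" "\<delta> s \<in> U'" "U \<inter> U' = {}"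
      using hausdorff[OF False] by blast
    have "\<forall>\<^sub>F r in at s within I. \<gamma> r \<in> U \<and> \<delta> r \<in> U'"
      using topological_tendstoD[OF flowline_tendsto[OF g s] U(1,3)]
        topological_tendstoD[OF flowline_tendsto[OF d s] U(2,4)] by eventually_elim simp
    then obtain S where S: "open S" "s \<in> S" "\<And>r. r \<in> S \<Longrightarrow> r \<noteq> s \<Longrightarrow> r \<in> I \<Longrightarrow> \<gamma> r \<in> U \<and> \<delta> r \<in> U'"
      unfolding eventually_at_topological by blast
    have "\<gamma> r \<noteq> \<delta> r" if "r \<in> I \<inter> S" for r
      using S(3)[of r] that U(5) False by (cases "r = s") auto
    then show ?thesis using s S(1,2)
      by (intro exI[of _ "I \<inter> S"]) (auto intro: openin_open_Int)
  qed
qed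

section \<open>The partial maps F^t and their group law\<close>

abbreviation "flow \<equiv> translation_flow \<A> \<alpha>"

lemma flow_iff: "(x, y) \<in> flow t \<longleftrightarrow> (\<exists>\<gamma>. flowline (closed_segment 0 t) \<gamma> \<and> \<gamma> 0 = x \<and> \<gamma> t = y)"
  unfolding translation_flow_def trajectory_iff_flowline by auto

lemma flow_functional: "(x, y) \<in> flow t \<Longrightarrow> (x, z) \<in> flow t \<Longrightarrow> y = z"
  unfolding flow_iff using flowline_unique[where I = "closed_segment 0 t" and a = 0 and b = t] by force

text \<open>The same curve is used, with its time origin moved to the other end.\<close>

lemma flow_uminus: "(x, y) \<in> flow t \<Longrightarrow> (y, x) \<in> flow (- t)"
proof -
  assume "(x, y) \<in> flow t"
  then obtain \<gamma> where g: "flowline (closed_segment 0 t) \<gamma>" "\<gamma> 0 = x" "\<gamma> t = y"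
    unfolding flow_iff by blast
  have "closed_segment 0 (- t) = (+) (- t) ` closed_segment 0 t"
    using closed_segment_translation[of "- t" 0 t] by (simp add: closed_segment_commute)
  then have "flowline (closed_segment 0 (- t)) (\<lambda>s. \<gamma> (s - - t))"
    using flowline_shift[OF g(1), of "- t"] by simp
  then show "(y, x) \<in> flow (- t)" unfolding flow_iff using g(2,3) by auto
qed

lemma flow_converse: "(flow t)\<inverse> = flow (- t)"
  using flow_uminus[of _ _ t] flow_uminus[of _ _ "- t"] by auto

lemma flow_injective: "(x, y) \<in> flow t \<Longrightarrow> (x', y) \<in> flow t \<Longrightarrow> x = x'"
  using flow_uminus flow_functional by blast

lemma flow_add:
  assumes "(x, y) \<in> flow s" "(y, z) \<in> flow t"
  shows "(x, z) \<in> flow (s + t)"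
proof -
  obtain \<gamma> \<delta> where g: "flowline (closed_segment 0 s) \<gamma>" "\<gamma> 0 = x" "\<gamma> s = y"
    and d: "flowline (closed_segment 0 t) \<delta>" "\<delta> 0 = y" "\<delta> t = z"
    using assms unfolding flow_iff by blast
  let ?I = "closed_segment 0 s" and ?J = "closed_segment s (s + t)"
  define \<eta> where "\<eta> r = (if r \<in> ?I then \<gamma> r else \<delta> (r - s))" for r
  have dJ: "flowline ?J (\<lambda>r. \<delta> (r - s))"
    using flowline_shift[OF d(1), of s] closed_segment_translation[of s 0 t] by simp
  \<comment> \<open>For \<open>s\<close> and \<open>t\<close> of opposite signs the two time
    segments overlap in more than the single time \<open>s\<close>. Both curves are at
    \<open>y\<close> at time \<open>s\<close>, so uniqueness makes the glued curve
    consistent.\<close>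
  have agree: "\<gamma> r = \<delta> (r - s)" if "r \<in> ?I" "r \<in> ?J" for r
  proof (rule flowline_unique[where I = "?I \<inter> ?J" and a = s and \<gamma> = \<gamma> and \<delta> = "\<lambda>r. \<delta> (r - s)"])
    show "connected (?I \<inter> ?J)" by (intro convex_connected convex_Int) auto
    show "flowline (?I \<inter> ?J) \<gamma>" using g(1) by (rule flowline_subset) auto
    show "flowline (?I \<inter> ?J) (\<lambda>r. \<delta> (r - s))" using dJ by (rule flowline_subset) auto
  next
    show "\<gamma> s = \<delta> (s - s)" using g d by simp
  qed (use that in auto)
  have "flowline ?I \<eta>" by (rule flowline_cong[OF g(1)]) (simp add: \<eta>_def)
  moreover have "flowline ?J \<eta>" by (rule flowline_cong[OF dJ]) (simp add: \<eta>_def agree)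
  ultimately have "flowline (?I \<union> ?J) \<eta>" by (rule flowline_Un) auto
  \<comment> \<open>With opposite signs the union of the segments is longer than the segment from 0
    to \<open>s + t\<close>, hence a restriction.\<close>
  then have "flowline (closed_segment 0 (s + t)) \<eta>"
    by (rule flowline_subset) (auto simp: closed_segment_eq_real_ivl split: if_splits)
  moreover have "\<eta> 0 = x" using g(2) by (simp add: \<eta>_def)
  moreover have "\<eta> (s + t) = z" using d(3) agree[of "s + t"] by (simp add: \<eta>_def)
  ultimately show ?thesis unfolding flow_iff by blast
qed

section \<open>Flow boxes: F^t as a translation near each point of its domain\<close>

lemma flow_in_tchart:
  assumes V: "tchart V \<psi>" and x: "x \<in> V"
    and seg: "\<And>u. u \<in> closed_segment 0 t \<Longrightarrow> \<psi> x + of_real u \<in> \<psi> ` V"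
  shows "(x, inv_into V \<psi> (\<psi> x + of_real t)) \<in> flow t"
  unfolding flow_iff
proof (intro exI conjI)
  let ?g = "\<lambda>u. inv_into V \<psi> (\<psi> x + of_real u)"
  show "flowline (closed_segment 0 t) ?g"
    unfolding flowline_def
  proof
    fix s assume s: "s \<in> closed_segment 0 t"
    show "\<exists>V \<psi>. tchart V \<psi> \<and> ?g s \<in> V \<and> (\<exists>e>0. \<forall>r\<in>closed_segment 0 t. dist r s < e \<longrightarrow>
        ?g r \<in> V \<and> \<psi> (?g r) = \<psi> (?g s) + of_real (r - s))"
      using V inv_tchart(2,3)[OF V seg] s
      by (intro exI[of _ V] exI[of _ \<psi>] conjI exI[of _ "1::real"]) auto
  qed
  show "?g 0 = x" using V x by simp
qed simp

text \<open>Asking for a translation in all charts around \<open>x\<close> and \<open>y\<close>, rather than in some, makes flow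
  boxes composable.\<close>

definition flow_box :: "'a \<Rightarrow> real \<Rightarrow> 'a \<Rightarrow> bool" where
  "flow_box x t y \<longleftrightarrow> (\<exists>f. f x = y \<and> isCont f x \<and> (\<forall>\<^sub>F z in nhds x. (z, f z) \<in> flow t) \<and>
     (\<forall>V \<phi> W \<psi>. tchart V \<phi> \<longrightarrow> tchart W \<psi> \<longrightarrow> x \<in> V \<longrightarrow> y \<in> W \<longrightarrow>
        (\<forall>\<^sub>F z in nhds x. \<psi> (f z) - \<phi> z = \<psi> y - \<phi> x)))"

text \<open>For \<open>z\<close> near \<open>x\<close> both ends of the horizontal segment starting
  at \<open>\<psi> z\<close> lie in \<open>B\<close>. By convexity the whole segment does, so the
  trajectory of \<open>z\<close> stays in the chart up to time \<open>t\<close>.\<close>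

lemma flow_box_in_tchart:
  assumes V: "tchart V \<psi>" and xy: "x \<in> V" "y \<in> V" and t: "\<psi> y = \<psi> x + of_real t"
    and B: "open B" "convex B" "B \<subseteq> \<psi> ` V" "\<psi> x \<in> B" "\<psi> y \<in> B"
  shows "flow_box x t y"
proof -
  define f where "f z = inv_into V \<psi> (\<psi> z + of_real t)" for z
  have cont: "isCont \<psi> x"
    using tchart_continuous[OF V] tchart_openD[OF V] xy(1) by (simp add: continuous_on_eq_continuous_at)
  then have lim: "((\<lambda>z. \<psi> z) \<longlongrightarrow> \<psi> x) (nhds x)"
    by (simp add: isCont_def tendsto_nhds_iff)
  have ev1: "\<forall>\<^sub>F z in nhds x. \<psi> z \<in> B"
    using lim B(1,4) by (rule topological_tendstoD)
  have "((\<lambda>z. \<psi> z + of_real t) \<longlongrightarrow> \<psi> y) (nhds x)"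
    unfolding t by (intro tendsto_intros lim)
  then have ev2: "\<forall>\<^sub>F z in nhds x. \<psi> z + of_real t \<in> B"
    using B(1,5) by (rule topological_tendstoD)
  have ev3: "\<forall>\<^sub>F z in nhds x. z \<in> V"
    using tchart_openD[OF V] xy(1) by (rule eventually_nhds_in_open)
  have fx: "f x = y" using V xy t[symmetric] by (simp add: f_def)
  have cf: "isCont f x"
  proof -
    have "isCont (\<lambda>z. \<psi> z + of_real t) x" using cont by (intro continuous_intros)
    moreover have "isCont (inv_into V \<psi>) (\<psi> x + of_real t)"
      unfolding t[symmetric] using inv_tchart(1)[OF V] xy(2) by blast
    ultimately show ?thesis unfolding f_def by (rule isCont_o2)
  qed
  have in_flow: "\<forall>\<^sub>F z in nhds x. (z, f z) \<in> flow t"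
    using ev1 ev2 ev3
  proof eventually_elim
    case (elim z)
    have "\<psi> z + of_real u \<in> \<psi> ` V" if u: "u \<in> closed_segment 0 t" for u
    proof -
      obtain w where w: "0 \<le> w" "w \<le> 1" "u = w * t" using u by (auto simp: in_segment)
      have "(1 - w) *\<^sub>R \<psi> z + w *\<^sub>R (\<psi> z + of_real t) \<in> B"
        using B(2) elim w(1,2) by (intro convexD) auto
      also have "(1 - w) *\<^sub>R \<psi> z + w *\<^sub>R (\<psi> z + of_real t) = \<psi> z + of_real u"
        by (simp add: w(3) scaleR_conv_of_real algebra_simps)
      finally show ?thesis using B(3) by blast
    qed
    then show ?case unfolding f_def using V elim by (intro flow_in_tchart)
  qed
  show ?thesis
    unfolding flow_box_def
  proof (intro exI[of _ f] conjI allI impI fx cf in_flow)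
    fix U \<phi> W \<psi>'
    assume c: "tchart U \<phi>" "tchart W \<psi>'" "x \<in> U" "y \<in> W"
    \<comment> \<open>Arbitrary charts at the two ends differ from \<open>\<psi>\<close> by local
      constants, so the displacement stays constant when they replace \<open>\<psi>\<close>.\<close>
    have "\<forall>\<^sub>F z in nhds y. \<psi>' z - \<psi> z = \<psi>' y - \<psi> y"
      by (rule tchart_diff[OF V c(2) xy(2) c(4)])
    then have "\<forall>\<^sub>F z in nhds x. \<psi>' (f z) - \<psi> (f z) = \<psi>' y - \<psi> y"
    proof (rule eventually_compose_filterlim)
      show "filterlim f (nhds y) (nhds x)" using cf fx by (simp add: isCont_def tendsto_nhds_iff)
    qed
    moreover have "\<forall>\<^sub>F z in nhds x. \<phi> z - \<psi> z = \<phi> x - \<psi> x"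
      by (rule tchart_diff[OF V c(1) xy(1) c(3)])
    ultimately show "\<forall>\<^sub>F z in nhds x. \<psi>' (f z) - \<phi> z = \<psi>' y - \<phi> x" using ev2
    proof eventually_elim
      case (elim z)
      have "\<psi> (f z) = \<psi> z + of_real t" unfolding f_def using inv_tchart(3)[OF V] elim(3) B(3) by blast
      then show ?case
        unfolding iffD1[OF diff_eq_eq elim(1)] iffD1[OF diff_eq_eq elim(2)] t by simp
    qed
  qed
qed

text \<open>Displacements are added through a chart at the intermediate point.
  \<open>flow_box\<close> mentions charts only conditionally, hence the explicit chart at
  \<open>y\<close>.\<close>

lemma flow_box_trans:
  assumes "flow_box x s y" "flow_box y t z" and V: "tchart V \<psi>" "y \<in> V"
  shows "flow_box x (s + t) z"
proof -
  obtain f where f: "f x = y" "isCont f x" "\<forall>\<^sub>F w in nhds x. (w, f w) \<in> flow s"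
    "\<And>V \<phi> W \<psi>. tchart V \<phi> \<Longrightarrow> tchart W \<psi> \<Longrightarrow> x \<in> V \<Longrightarrow> y \<in> W \<Longrightarrow>
        \<forall>\<^sub>F z in nhds x. \<psi> (f z) - \<phi> z = \<psi> y - \<phi> x"
    using assms(1) unfolding flow_box_def by blast
  obtain g where g: "g y = z" "isCont g y" "\<forall>\<^sub>F w in nhds y. (w, g w) \<in> flow t"
    "\<And>V \<phi> W \<psi>. tchart V \<phi> \<Longrightarrow> tchart W \<psi> \<Longrightarrow> y \<in> V \<Longrightarrow> z \<in> W \<Longrightarrow>
        \<forall>\<^sub>F w in nhds y. \<psi> (g w) - \<phi> w = \<psi> z - \<phi> y"
    using assms(2) unfolding flow_box_def by blast
  have lim: "filterlim f (nhds y) (nhds x)"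
    using f(1,2) by (simp add: isCont_def tendsto_nhds_iff)
  have "\<forall>\<^sub>F w in nhds x. (w, g (f w)) \<in> flow (s + t)"
    using f(3) eventually_compose_filterlim[OF g(3) lim]
    by eventually_elim (rule flow_add)
  moreover have "\<forall>\<^sub>F w in nhds x. \<psi>' (g (f w)) - \<phi> w = \<psi>' z - \<phi> x"
    if c: "tchart U \<phi>" "tchart W \<psi>'" "x \<in> U" "z \<in> W" for U \<phi> W \<psi>'
    using f(4)[OF c(1) V(1) c(3) V(2)] eventually_compose_filterlim[OF g(4)[OF V(1) c(2) V(2) c(4)] lim]
  proof eventually_elim
    case (elim w)
    \<comment> \<open>Adding the two displacement equations cancels the values of the intermediate
      chart \<open>\<psi>\<close>.\<close>
    show ?case using arg_cong2[OF elim, of "(+)"] by simp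
  qed
  moreover have "isCont (\<lambda>w. g (f w)) x"
    using f(2) by (rule isCont_o2) (use f(1) g(2) in simp)
  ultimately show ?thesis unfolding flow_box_def using f(1) g(1)
    by (intro exI[of _ "\<lambda>w. g (f w)"]) auto
qed

text \<open>Any two sufficiently close times on a trajectory lie in one chart and give a flow box.
  Connectedness of the time segment chains these boxes from 0 to \<open>t\<close>.\<close>

lemma flow_imp_flow_box:
  assumes "(x, y) \<in> flow t"
  shows "flow_box x t y"
proof -
  obtain \<gamma> where g: "flowline (closed_segment 0 t) \<gamma>" "\<gamma> 0 = x" "\<gamma> t = y"
    using assms unfolding flow_iff by blast
  have loc: "\<exists>T. openin (top_of_set (closed_segment 0 t)) T \<and> s \<in> T \<and>
      (\<forall>r\<in>T. \<forall>r'\<in>T. flow_box (\<gamma> r) (r' - r) (\<gamma> r'))" if s: "s \<in> closed_segment 0 t" for s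
  proof -
    obtain V \<psi> e where V: "tchart V \<psi>" "\<gamma> s \<in> V" "e > 0"
      "\<And>r. r \<in> closed_segment 0 t \<Longrightarrow> dist r s < e \<Longrightarrow> \<gamma> r \<in> V \<and> \<psi> (\<gamma> r) = \<psi> (\<gamma> s) + of_real (r - s)"
      by (rule flowlineE[OF g(1) s]) blast
    have "open (\<psi> ` V)" using tchart_open_image[OF V(1) tchart_openD[OF V(1)]] by blast
    then obtain d where d: "d > 0" "ball (\<psi> (\<gamma> s)) d \<subseteq> \<psi> ` V" using V(2) by (meson imageI openE)
    let ?T = "closed_segment 0 t \<inter> ball s (min d e)"
    have T: "\<gamma> r \<in> V" "\<psi> (\<gamma> r) = \<psi> (\<gamma> s) + of_real (r - s)" "\<psi> (\<gamma> r) \<in> ball (\<psi> (\<gamma> s)) d"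
      if r: "r \<in> ?T" for r
    proof -
      show *: "\<gamma> r \<in> V" "\<psi> (\<gamma> r) = \<psi> (\<gamma> s) + of_real (r - s)"
        using V(4)[of r] r by (auto simp: dist_commute)
      have "dist (\<psi> (\<gamma> s)) (\<psi> (\<gamma> r)) = \<bar>r - s\<bar>"
        unfolding * dist_norm by (simp flip: of_real_diff)
      then show "\<psi> (\<gamma> r) \<in> ball (\<psi> (\<gamma> s)) d" using r by (auto simp: dist_real_def)
    qed
    have "flow_box (\<gamma> r) (r' - r) (\<gamma> r')" if r: "r \<in> ?T" "r' \<in> ?T" for r r'
      by (rule flow_box_in_tchart[OF V(1), where B = "ball (\<psi> (\<gamma> s)) d"])
        (use T[OF r(1)] T[OF r(2)] d(2) in auto)
    then show ?thesis using s d(1) V(3)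
      by (intro exI[of _ ?T]) (auto intro: openin_open_Int)
  qed
  have "flow_box (\<gamma> 0) (t - 0) (\<gamma> t)"
  proof (rule connected_induction_simple[where P = "\<lambda>s. flow_box (\<gamma> 0) (s - 0) (\<gamma> s)" and S = "closed_segment 0 t" and a = 0])
    show "flow_box (\<gamma> 0) (0 - 0) (\<gamma> 0)" using loc[of 0] by auto
    fix s assume s: "s \<in> closed_segment 0 t"
    from loc[OF s] obtain T where T: "openin (top_of_set (closed_segment 0 t)) T" "s \<in> T"
      "\<And>r r'. r \<in> T \<Longrightarrow> r' \<in> T \<Longrightarrow> flow_box (\<gamma> r) (r' - r) (\<gamma> r')" by blast
    have "flow_box (\<gamma> 0) (r' - 0) (\<gamma> r')" if r: "r \<in> T" "r' \<in> T" "flow_box (\<gamma> 0) (r - 0) (\<gamma> r)" for r r'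
    proof -
      have "r \<in> closed_segment 0 t" using r(1) openin_imp_subset[OF T(1)] by blast
      then obtain V \<psi> where "tchart V \<psi>" "\<gamma> r \<in> V" using flowlineE[OF g(1)] by metis
      from flow_box_trans[OF r(3) T(3)[OF r(1,2)] this] show ?thesis by simp
    qed
    then show "\<exists>T. openin (top_of_set (closed_segment 0 t)) T \<and> s \<in> T \<and>
      (\<forall>r\<in>T. \<forall>r'\<in>T. flow_box (\<gamma> 0) (r - 0) (\<gamma> r) \<longrightarrow> flow_box (\<gamma> 0) (r' - 0) (\<gamma> r'))"
      using T(1,2) by blast
  qed auto
  then show ?thesis using g by simp
qed

section \<open>Measurability and area under the flow\<close>

lemma open_Domain_flow: "open (Domain (flow t))"
proof (subst open_subopen, safe)
  fix x y assume "(x, y) \<in> flow t"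
  then obtain f where "\<forall>\<^sub>F z in nhds x. (z, f z) \<in> flow t"
    using flow_imp_flow_box unfolding flow_box_def by blast
  then obtain T where "open T" "x \<in> T" "\<And>z. z \<in> T \<Longrightarrow> (z, f z) \<in> flow t"
    unfolding eventually_nhds by blast
  then show "\<exists>T. open T \<and> x \<in> T \<and> T \<subseteq> Domain (flow t)"
    by (intro exI[of _ T]) auto
qed

lemma flow_point_tchart:
  assumes "(x, y) \<in> flow t"
  obtains V \<phi> W \<psi> where "tchart V \<phi>" "x \<in> V" "tchart W \<psi>" "y \<in> W"
proof -
  obtain \<gamma> where g: "flowline (closed_segment 0 t) \<gamma>" "\<gamma> 0 = x" "\<gamma> t = y"
    using assms unfolding flow_iff by blast
  have "\<exists>V \<psi>. tchart V \<psi> \<and> \<gamma> s \<in> V" if "s \<in> closed_segment 0 t" for s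
    by (rule flowlineE[OF g(1) that]) blast
  then obtain V \<phi> W \<psi> where "tchart V \<phi>" "x \<in> V" "tchart W \<psi>" "y \<in> W"
    using g(2,3) ends_in_segment[of 0 t] by blast
  then show thesis by (rule that)
qed

lemma flow_image_area:
  assumes E: "E \<in> sets borel" "E \<subseteq> Domain (flow t)"
  shows "flow t `` E \<in> sets borel" "emeasure area (flow t `` E) = emeasure area E"
proof -
  define g where "g x = (SOME y. (x, y) \<in> flow t)" for x
  have g: "(x, g x) \<in> flow t" if "x \<in> Domain (flow t)" for x
    using that unfolding g_def by (auto intro: someI)
  have g': "g x = y" if "(x, y) \<in> flow t" for x y
    using flow_functional[OF g[OF DomainI[OF that]] that] .
  have gE: "g ` E = flow t `` E" using g g' E(2) by blast
  have inj: "inj_on g E"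
    using g E(2) flow_injective by (metis inj_onI subsetD)
  have loc: "\<exists>U. open U \<and> x \<in> U \<and> (\<forall>X\<in>sets borel. X \<subseteq> U \<inter> E \<longrightarrow>
      g ` X \<in> sets area \<and> emeasure area (g ` X) = emeasure area X)" if x: "x \<in> E" for x
  proof -
    have gx: "(x, g x) \<in> flow t" using x E g by blast
    obtain V \<phi> W \<psi> where c: "tchart V \<phi>" "x \<in> V" "tchart W \<psi>" "g x \<in> W"
      by (rule flow_point_tchart[OF gx])
    define k where "k = \<psi> (g x) - \<phi> x"
    obtain f where f: "f x = g x" "isCont f x" "\<forall>\<^sub>F z in nhds x. (z, f z) \<in> flow t"
      "\<forall>\<^sub>F z in nhds x. \<psi> (f z) - \<phi> z = k"
      using flow_imp_flow_box[OF gx] c unfolding flow_box_def k_def by blast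
    have "filterlim f (nhds (g x)) (nhds x)"
      using f(1,2) by (simp add: isCont_def tendsto_nhds_iff)
    then have "\<forall>\<^sub>F z in nhds x. f z \<in> W"
      using tchart_openD[OF c(3)] c(4) by (rule topological_tendstoD)
    moreover have "\<forall>\<^sub>F z in nhds x. z \<in> V"
      using tchart_openD[OF c(1)] c(2) by (rule eventually_nhds_in_open)
    ultimately have "\<forall>\<^sub>F z in nhds x. z \<in> V \<and> g z \<in> W \<and> \<psi> (g z) = \<phi> z + k"
      using f(3,4)
    proof eventually_elim
      case (elim z)
      then show ?case using g'[OF elim(3)] by (simp add: algebra_simps)
    qed
    then obtain U where U: "open U" "x \<in> U"
      "\<And>z. z \<in> U \<Longrightarrow> z \<in> V \<and> g z \<in> W \<and> \<psi> (g z) = \<phi> z + k"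
      unfolding eventually_nhds by blast
    show ?thesis
    proof (intro exI[of _ U] conjI ballI impI U(1,2))
      fix X assume X: "X \<in> sets borel" "X \<subseteq> U \<inter> E"
      have XV: "X \<subseteq> V" "g ` X \<subseteq> W" using X(2) U(3) by blast+
      let ?Y = "(\<lambda>z. z + k) ` \<phi> ` X"
      have pX: "\<phi> ` X \<in> sets borel" by (rule tchart_borel_image[OF c(1) X(1) XV(1)])
      have eq: "\<psi> ` g ` X = ?Y" using X(2) U(3) unfolding image_image by (intro image_cong) auto
      \<comment> \<open>As \<open>\<psi>\<close> is injective on \<open>W\<close>, the image is a
        chart preimage of a translated Borel set of the plane; this yields its
        measurability.\<close>
      have "g ` X = W \<inter> \<psi> -` ?Y"
      proof
        show "g ` X \<subseteq> W \<inter> \<psi> -` ?Y" using XV(2) eq by blast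
        show "W \<inter> \<psi> -` ?Y \<subseteq> g ` X"
        proof safe
          fix w z assume w: "w \<in> W" "\<psi> w = \<phi> z + k" and z: "z \<in> X"
          have "\<psi> w = \<psi> (g z)" "g z \<in> W" using w z X(2) U(3) by auto
          then have "w = g z" using inj_onD[OF tchart_injD[OF c(3)]] w(1) by blast
          then show "w \<in> g ` X" using z by blast
        qed
      qed
      then have gb: "g ` X \<in> sets borel"
        using continuous_on_vimage_borel[OF tchart_continuous[OF c(3)]] tchart_openD[OF c(3)]
          emeasure_lborel_translate(1)[OF pX] by auto
      then show "g ` X \<in> sets area" by simp
      have "emeasure area (g ` X) = emeasure lborel (\<psi> ` g ` X)"
        by (rule emeasure_area_tchart[OF c(3) gb XV(2)])
      also have "\<dots> = emeasure lborel (\<phi> ` X)" unfolding eq by (rule emeasure_lborel_translate(2)[OF pX])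
      also have "\<dots> = emeasure area X" by (rule emeasure_area_tchart[OF c(1) X(1) XV(1), symmetric])
      finally show "emeasure area (g ` X) = emeasure area X" .
    qed
  qed
  note * = image_measure_preserving_local[OF sets_area E(1) inj loc]
  show "flow t `` E \<in> sets borel" using *(1) gE by simp
  show "emeasure area (flow t `` E) = emeasure area E" using *(2) gE by simp
qed

lemma flow_vimage_borel:
  assumes "A \<in> sets borel"
  shows "(flow t)\<inverse> `` A \<in> sets borel"
proof -
  have "(flow t)\<inverse> `` A = flow (- t) `` (A \<inter> Domain (flow (- t)))" unfolding flow_converse by blast
  then show ?thesis
    using flow_image_area(1)[of "A \<inter> Domain (flow (- t))" "- t"] assms open_Domain_flow[of "- t"] by auto
qed

text \<open>A preimage under F^t is an image under F^-t, so what must be discarded is the complement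
  of the domain at time \<open>- t\<close>, which is null because the flow is defined almost
  everywhere for negative times too.\<close>

lemma area_flow_invariant:
  assumes ae: "flow_defined_ae \<A> \<alpha>"
  shows "flow_invariant \<A> \<alpha> area"
  unfolding flow_invariant_def
proof safe
  fix t and A :: "'a set" assume A: "A \<in> sets borel"
  let ?D = "Domain (flow (- t))"
  have D: "?D \<in> sets borel" using open_Domain_flow by auto
  have "(flow t)\<inverse> `` A = flow (- t) `` (A \<inter> ?D)" unfolding flow_converse by blast
  then have "emeasure area ((flow t)\<inverse> `` A) = emeasure area (A \<inter> ?D)"
    using flow_image_area(2)[of "A \<inter> ?D" "- t"] A D by auto
  also have "\<dots> = emeasure area A"
  proof (rule emeasure_eq_AE)
    have "AE x in area. x \<in> ?D" using ae unfolding flow_defined_ae_def by blast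
    then show "AE x in area. x \<in> A \<inter> ?D \<longleftrightarrow> x \<in> A" by eventually_elim auto
  qed (use A D in auto)
  finally show "emeasure area ((flow t)\<inverse> `` A) = emeasure area A" .
qed

end


section \<open>Finite covers\<close>

locale translation_cover =
  base: translation_surf \<A> \<alpha> + cover: translation_surf \<B> \<beta>
  for \<A> :: "'a::{t2_space,second_countable_topology} chart set" and \<alpha> :: "'a form"
    and \<B> :: "'b::{t2_space,second_countable_topology} chart set" and \<beta> :: "'b form" +
  fixes p :: "'b \<Rightarrow> 'a"
  assumes cov: "finite_translation_cover \<B> \<beta> \<A> \<alpha> p"
begin

section \<open>The covering map in translation charts\<close>

lemma covering: "covering_space UNIV p UNIV"
  using cov unfolding finite_translation_cover_def by blast

lemma continuous_p: "continuous_on UNIV p"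
  using covering by (rule covering_space_imp_continuous)

lemma surj_p: "p ` UNIV = UNIV"
  using covering by (rule covering_space_imp_surjective)

lemma open_vimage_p: "open V \<Longrightarrow> open (p -` V)"
  using continuous_p by (simp add: open_vimage)

lemma measurable_p: "p \<in> borel_measurable borel"
  using continuous_p by (rule borel_measurable_continuous_onI)

lemma vimage_p_borel: "X \<in> sets borel \<Longrightarrow> p -` X \<in> sets borel"
  using measurable_sets[OF measurable_p] by simp

lemma pullback:
  assumes "b \<in> \<B>" "a \<in> \<A>" "y \<in> fst b" "p y \<in> fst a"
  defines "g \<equiv> snd a \<circ> p \<circ> inv_into (fst b) (snd b)"
  shows "(g has_field_derivative deriv g (snd b y)) (at (snd b y))"
    "\<beta> b (snd b y) = \<alpha> a (snd a (p y)) * deriv g (snd b y)"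
  using cov assms unfolding finite_translation_cover_def Let_def
  by (auto simp: field_differentiable_derivI)

text \<open>The chain rule through an atlas chart \<open>a\<close> below turns the pullback formula
  into the derivative condition. The open set \<open>U\<close> is there because \<open>p\<close> is
  injective only locally.\<close>

lemma lift_tchart:
  assumes V: "base.tchart V \<psi>" and U: "open U" "inj_on p U"
  shows "cover.tchart (U \<inter> p -` V) (\<psi> \<circ> p)"
  unfolding translation_chart_def
proof (intro conjI ballI)
  show "open (U \<inter> p -` V)" using U open_vimage_p base.tchart_openD[OF V] by auto
  show "inj_on (\<psi> \<circ> p) (U \<inter> p -` V)"
    using U(2) base.tchart_injD[OF V] unfolding inj_on_def by auto
  fix b z assume b: "b \<in> \<B>" and "z \<in> overlap b (U \<inter> p -` V, \<psi> \<circ> p)"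
  then obtain y where y: "y \<in> fst b" "y \<in> U" "p y \<in> V" "z = snd b y" unfolding overlap_def by auto
  obtain a where a: "a \<in> \<A>" "p y \<in> fst a" by (rule base.ex_atlas)
  let ?i = "inv_into (fst b) (snd b)"
  let ?g = "snd a \<circ> p \<circ> ?i"
  let ?T = "transition a (V, \<psi>)"
  have iy: "?i z = y" using y cover.atlasD(4)[OF b] by simp
  note g = pullback[OF b a(1) y(1) a(2)]
  have D: "(?T \<circ> ?g has_field_derivative \<beta> b z) (at z)"
    unfolding y(4) g(2)
    by (rule DERIV_chain) (use base.tchart_derivative[OF V a y(3)] g(1) iy y in auto)
  let ?W = "snd b ` (fst b \<inter> p -` fst a)"
  have W: "open ?W"
    by (rule cover.atlasD(7)[OF b]) (use cover.atlasD(1)[OF b] base.atlasD(1)[OF a(1)] open_vimage_p in auto)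
  \<comment> \<open>The composite through \<open>a\<close> agrees with the required transition only
    on the open set \<open>?W\<close>, which is enough to transfer the derivative at
    \<open>z\<close>.\<close>
  have "(?T \<circ> ?g) w = transition b (U \<inter> p -` V, \<psi> \<circ> p) w" if w: "w \<in> ?W" for w
  proof -
    obtain x where x: "x \<in> fst b" "p x \<in> fst a" "w = snd b x" using w by auto
    have "?i w = x" using x cover.atlasD(4)[OF b] by simp
    then show ?thesis using base.atlasD(4)[OF a(1)] x(2) by (simp add: transition_def)
  qed
  then show "(transition b (U \<inter> p -` V, \<psi> \<circ> p) has_field_derivative \<beta> b z) (at z)"
    using has_field_derivative_transform_within_open[OF D W] y a by blast
qed

lemma local_section:
  obtains U q where "y \<in> U" "open U" "open (p ` U)" "homeomorphism U (p ` U) p q"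
proof -
  obtain U W q where U: "y \<in> U" "openin (top_of_set UNIV) U" "openin (top_of_set UNIV) W"
    "homeomorphism U W p q"
    by (rule covering_space_local_homeomorphism[OF covering, of y]) auto
  have "p ` U = W" using U(4) unfolding homeomorphism_def by blast
  then show thesis using that[of U q] U by simp
qed

text \<open>The pullback formula lifts zeros at once. Conversely, a zero above might come from a
  vanishing derivative of \<open>p\<close> in coordinates; a lifted chart around the point excludes
  this.\<close>

lemma zeros_cover_iff: "y \<in> form_zeros \<B> \<beta> \<longleftrightarrow> p y \<in> form_zeros \<A> \<alpha>"
proof
  assume y: "y \<in> form_zeros \<B> \<beta>"
  show "p y \<in> form_zeros \<A> \<alpha>"
  proof (rule ccontr)
    assume "p y \<notin> form_zeros \<A> \<alpha>"
    then obtain V \<psi> where V: "base.tchart V \<psi>" "p y \<in> V" by (rule base.ex_tchart)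
    obtain U q where U: "y \<in> U" "open U" "homeomorphism U (p ` U) p q" by (rule local_section)
    have "cover.tchart (U \<inter> p -` V) (\<psi> \<circ> p)"
      using V(1) U(2) homeomorphism_imp_inj_on[OF U(3)] by (rule lift_tchart)
    then show False using cover.tchart_nonzero y U(1) V(2) by blast
  qed
next
  assume "p y \<in> form_zeros \<A> \<alpha>"
  then obtain a where a: "a \<in> \<A>" "p y \<in> fst a" "\<alpha> a (snd a (p y)) = 0"
    unfolding form_zeros_def by auto
  obtain b where b: "b \<in> \<B>" "y \<in> fst b" by (rule cover.ex_atlas)
  have "\<beta> b (snd b y) = 0" using pullback(2)[OF b(1) a(1) b(2) a(2)] a(3) by simp
  then show "y \<in> form_zeros \<B> \<beta>" using b unfolding form_zeros_def by blast
qed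

text \<open>A chart \<open>\<psi>\<close> below and its lift \<open>\<psi> \<circ> p\<close> have
  the same planar image, so the two areas agree in charts. The zeros lie in no chart; they are
  removed first and restored as null sets.\<close>

lemma section_area:
  assumes U: "open U" "open (p ` U)" "homeomorphism U (p ` U) p q"
    and E: "E \<in> sets borel" "E \<subseteq> U"
  shows "p ` E \<in> sets borel" "emeasure base.area (p ` E) = emeasure cover.area E"
proof -
  have inj: "inj_on p U" using U(3) by (rule homeomorphism_imp_inj_on)
  have pb: "p ` X \<in> sets borel" if "X \<in> sets borel" "X \<subseteq> U" for X
    using homeomorphism_image_borel[OF U(3) _ that] U(2) by auto
  show pE: "p ` E \<in> sets borel" using pb E by blast
  let ?Z = "form_zeros \<B> \<beta>"
  have E0: "E - ?Z \<in> sets borel" using E(1) cover.closed_zeros by auto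
  have "emeasure base.area (p ` (E - ?Z)) = emeasure cover.area (E - ?Z)"
  proof (rule image_measure_preserving_local(2)[OF cover.sets_area E0])
    show "inj_on p (E - ?Z)" using inj E(2) by (meson Diff_subset inj_on_subset)
    fix y assume y: "y \<in> E - ?Z"
    then have "p y \<notin> form_zeros \<A> \<alpha>" using zeros_cover_iff by blast
    then obtain V \<psi> where V: "base.tchart V \<psi>" "p y \<in> V" by (rule base.ex_tchart)
    have ch: "cover.tchart (U \<inter> p -` V) (\<psi> \<circ> p)" using V(1) U(1) inj by (rule lift_tchart)
    show "\<exists>W. open W \<and> y \<in> W \<and> (\<forall>X\<in>sets borel. X \<subseteq> W \<inter> (E - ?Z) \<longrightarrow>
        p ` X \<in> sets base.area \<and> emeasure base.area (p ` X) = emeasure cover.area X)"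
    proof (intro exI[of _ "U \<inter> p -` V"] conjI ballI impI)
      show "open (U \<inter> p -` V)" using ch by (rule cover.tchart_openD)
      show "y \<in> U \<inter> p -` V" using y E(2) V(2) by auto
      fix X assume X: "X \<in> sets borel" "X \<subseteq> U \<inter> p -` V \<inter> (E - ?Z)"
      have pX: "p ` X \<in> sets borel" by (rule pb) (use X in auto)
      then show "p ` X \<in> sets base.area" by simp
      have "emeasure base.area (p ` X) = emeasure lborel (\<psi> ` p ` X)"
        by (rule base.emeasure_area_tchart[OF V(1) pX]) (use X in auto)
      also have "\<dots> = emeasure cover.area X"
        using cover.emeasure_area_tchart[OF ch X(1)] X(2) by (simp add: image_comp)
      finally show "emeasure base.area (p ` X) = emeasure cover.area X" .
    qed
  qed
  moreover have "emeasure cover.area (E - ?Z) = emeasure cover.area E"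
    using cover.zeros_null E(1) by (intro emeasure_Diff_null_set) auto
  moreover have "p ` (E - ?Z) = p ` E - form_zeros \<A> \<alpha>" using zeros_cover_iff by blast
  moreover have "emeasure base.area (p ` E - form_zeros \<A> \<alpha>) = emeasure base.area (p ` E)"
    using base.zeros_null pE by (intro emeasure_Diff_null_set) auto
  ultimately show "emeasure base.area (p ` E) = emeasure cover.area E" by simp
qed

text \<open>Countably many open sets on which \<open>p\<close> is a homeomorphism cover the surface
  above, and \<open>section_area\<close> applies on each of them.\<close>

lemma null_image:
  assumes E: "E \<in> null_sets cover.area"
  obtains N where "N \<in> null_sets base.area" "p ` E \<subseteq> N"
proof -
  let ?P = "\<lambda>U. open (p ` U) \<and> (\<exists>q. homeomorphism U (p ` U) p q)"
  have "\<exists>U. open U \<and> y \<in> U \<and> ?P U" for y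
    by (rule local_section[of y]) blast
  moreover have "?P {}" by (auto simp: homeomorphism_def)
  ultimately obtain U :: "nat \<Rightarrow> 'b set" where U: "\<And>n. open (U n)" "\<And>n. ?P (U n)" "UNIV \<subseteq> (\<Union>n. U n)"
    using countable_open_cover[of UNIV ?P] by metis
  have "p ` (E \<inter> U n) \<in> null_sets base.area" for n
  proof -
    obtain q where q: "homeomorphism (U n) (p ` U n) p q" using U(2) by blast
    have Eb: "E \<inter> U n \<in> sets borel" using E U(1)[of n] by (auto simp: null_sets_def)
    have "emeasure cover.area (E \<inter> U n) = 0"
      using E Eb by (metis Int_lower1 cover.sets_area emeasure_eq_0 null_setsD1 null_setsD2)
    then show ?thesis
      using section_area[OF U(1) _ q Eb] U(2) by (auto simp: null_sets_def)
  qed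
  then have "(\<Union>n. p ` (E \<inter> U n)) \<in> null_sets base.area" by (rule null_sets_UN)
  moreover have "p ` E \<subseteq> (\<Union>n. p ` (E \<inter> U n))" using U(3) by blast
  ultimately show thesis by (rule that)
qed

text \<open>Read in a lifted chart \<open>\<psi> \<circ> p\<close>, the condition on a curve above
  is literally the condition on its image in \<open>\<psi>\<close>.\<close>

lemma flow_project:
  assumes "(x, y) \<in> cover.flow t"
  shows "(p x, p y) \<in> base.flow t"
proof -
  obtain \<gamma> where g: "cover.flowline (closed_segment 0 t) \<gamma>" "\<gamma> 0 = x" "\<gamma> t = y"
    using assms unfolding cover.flow_iff by blast
  have "base.flowline (closed_segment 0 t) (\<lambda>s. p (\<gamma> s))"
    unfolding base.flowline_def
  proof
    fix s assume s: "s \<in> closed_segment 0 t"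
    obtain W \<phi> where "cover.tchart W \<phi>" "\<gamma> s \<in> W" by (rule cover.flowlineE[OF g(1) s]) blast
    then have "p (\<gamma> s) \<notin> form_zeros \<A> \<alpha>"
      using cover.tchart_nonzero zeros_cover_iff by blast
    then obtain V \<psi> where V: "base.tchart V \<psi>" "p (\<gamma> s) \<in> V" by (rule base.ex_tchart)
    obtain U q where U: "\<gamma> s \<in> U" "open U" "homeomorphism U (p ` U) p q" by (rule local_section)
    have "cover.tchart (U \<inter> p -` V) (\<psi> \<circ> p)"
      using V(1) U(2) homeomorphism_imp_inj_on[OF U(3)] by (rule lift_tchart)
    from cover.flowline_in_tchart[OF g(1) s this] U(1) V(2)
    obtain e where "e > 0" "\<And>r. r \<in> closed_segment 0 t \<Longrightarrow> dist r s < e \<Longrightarrow>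
      \<gamma> r \<in> U \<inter> p -` V \<and> (\<psi> \<circ> p) (\<gamma> r) = (\<psi> \<circ> p) (\<gamma> s) + of_real (r - s)" by blast
    then show "\<exists>V \<psi>. base.tchart V \<psi> \<and> p (\<gamma> s) \<in> V \<and> (\<exists>e>0. \<forall>r\<in>closed_segment 0 t.
        dist r s < e \<longrightarrow> p (\<gamma> r) \<in> V \<and> \<psi> (p (\<gamma> r)) = \<psi> (p (\<gamma> s)) + of_real (r - s))"
      using V by (intro exI[of _ V] exI[of _ \<psi>] conjI exI[of _ e]) auto
  qed
  then show ?thesis unfolding base.flow_iff using g(2,3) by blast
qed

text \<open>Over an evenly covered set there are at most \<open>d\<close> sheets, each carrying a
  copy of the area below. A countable disjoint decomposition of the base sums these bounds.\<close>

lemma emeasure_cover_area_finite: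
  assumes fin: "emeasure base.area UNIV < \<infinity>"
  shows "emeasure cover.area UNIV < \<infinity>"
proof -
  obtain d where d: "d > 0" "\<And>x. card (p -` {x}) = d"
    using cov unfolding finite_translation_cover_def by blast
  let ?P = "\<lambda>T. \<forall>X\<in>sets borel. X \<subseteq> T \<longrightarrow>
      emeasure cover.area (p -` X) \<le> of_nat d * emeasure base.area X"
  have loc: "\<exists>T. open T \<and> x \<in> T \<and> ?P T" for x
  proof -
    obtain T v where T: "x \<in> T" "open T" "\<Union>v = p -` T" "\<And>u. u \<in> v \<Longrightarrow> open u" "pairwise disjnt v"
      "\<And>u. u \<in> v \<Longrightarrow> \<exists>q. homeomorphism u T p q"
      using covering unfolding covering_space_def by auto metis
    have im: "p ` u = T" if "u \<in> v" for u
      using T(6)[OF that] unfolding homeomorphism_def by blast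
    have "\<exists>y. y \<in> u \<and> p y = x" if "u \<in> v" for u
      using im[OF that] T(1) by blast
    \<comment> \<open>One point over \<open>x\<close> is chosen in each sheet. Sheets are disjoint,
      so this injects them into the fibre and bounds their number by \<open>d\<close>.\<close>
    then obtain h where h: "\<And>u. u \<in> v \<Longrightarrow> h u \<in> u \<and> p (h u) = x" by metis
    have "inj_on h v"
      using h T(5) unfolding pairwise_def disjnt_def inj_on_def by (metis IntI empty_iff)
    moreover have "h ` v \<subseteq> p -` {x}" using h by blast
    \<comment> \<open>\<open>card\<close> is 0 on infinite sets, so \<open>d > 0\<close> forces
      finite fibres.\<close>
    moreover have "finite (p -` {x})" using d by (metis card_gt_0_iff)
    ultimately have v: "finite v" "card v \<le> d"
      using inj_on_finite[of h v] card_inj_on_le[of h v] d(2)[of x] by auto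
    have "?P T"
    proof (intro ballI impI)
      fix X assume X: "X \<in> sets borel" "X \<subseteq> T"
      have b: "u \<inter> p -` X \<in> sets borel" if "u \<in> v" for u
        using T(4)[OF that] vimage_p_borel[OF X(1)] by auto
      have "emeasure cover.area (u \<inter> p -` X) = emeasure base.area X" if u: "u \<in> v" for u
      proof -
        obtain q where q: "homeomorphism u (p ` u) p q" using T(6)[OF u] im[OF u] by auto
        have "p ` (u \<inter> p -` X) = X" using im[OF u] X(2) by blast
        then show ?thesis
          using section_area(2)[OF T(4)[OF u] _ q b[OF u]] im[OF u] T(2) by simp
      qed
      then have sum: "(\<Sum>u\<in>v. emeasure cover.area (u \<inter> p -` X)) = of_nat (card v) * emeasure base.area X"
        by simp
      have "p -` X = (\<Union>u\<in>v. u \<inter> p -` X)" using T(3) X(2) by blast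
      then have "emeasure cover.area (p -` X) \<le> (\<Sum>u\<in>v. emeasure cover.area (u \<inter> p -` X))"
        using emeasure_subadditive_finite[OF v(1), of "\<lambda>u. u \<inter> p -` X" cover.area] b by auto
      also have "\<dots> \<le> of_nat d * emeasure base.area X"
        unfolding sum using v(2) by (intro mult_right_mono) auto
      finally show "emeasure cover.area (p -` X) \<le> of_nat d * emeasure base.area X" .
    qed
    then show ?thesis using T(1,2) by blast
  qed
  have "?P {}" by simp
  with loc obtain T :: "nat \<Rightarrow> 'a set" where T: "\<And>n. open (T n)" "\<And>n. ?P (T n)" "UNIV \<subseteq> (\<Union>n. T n)"
    using countable_open_cover[of UNIV ?P] by metis
  have "range T \<subseteq> sets borel" using T(1) by auto
  then have Db: "range (disjointed T) \<subseteq> sets borel" by (rule sets.range_disjointed_sets)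
  have UD: "(\<Union>n. disjointed T n) = UNIV" using T(3) by (simp add: UN_disjointed_eq top.extremum_unique)
  have "emeasure cover.area UNIV = emeasure cover.area (\<Union>n. p -` disjointed T n)"
    using UD by (metis vimage_UN vimage_UNIV)
  also have "\<dots> \<le> (\<Sum>n. emeasure cover.area (p -` disjointed T n))"
    using Db vimage_p_borel by (intro emeasure_subadditive_countably) auto
  also have "\<dots> \<le> (\<Sum>n. of_nat d * emeasure base.area (disjointed T n))"
  proof (rule suminf_le)
    fix n
    have "disjointed T n \<in> sets borel" using Db by blast
    then show "emeasure cover.area (p -` disjointed T n) \<le> of_nat d * emeasure base.area (disjointed T n)"
      using T(2)[of n] disjointed_subset[of T n] by blast
  qed auto
  also have "\<dots> = of_nat d * (\<Sum>n. emeasure base.area (disjointed T n))"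
    by (rule ennreal_suminf_cmult)
  also have "\<dots> = of_nat d * emeasure base.area UNIV"
    using suminf_emeasure[of "disjointed T" base.area] Db disjoint_family_disjointed[of T] UD by simp
  also have "\<dots> < \<infinity>" 
    using fin of_nat_less_top[of d] unfolding infinity_ennreal_def ennreal_mult_less_top by blast
  finally show ?thesis .
qed

text \<open>Trajectories need not be lifted to the cover: the inclusion
  \<open>F\<^sup>-\<^sup>t (p\<^sup>-\<^sup>1 X) \<subseteq> p\<^sup>-\<^sup>1 (F\<^sup>-\<^sup>t X)\<close>, applied to \<open>X\<close> and to its complement, already gives equality of
  measures because \<open>\<nu>\<close> is finite.\<close>

lemma distr_flow_invariant:
  assumes \<nu>: "sets \<nu> = sets borel" "prob_space \<nu>" "flow_invariant \<B> \<beta> \<nu>"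
  shows "prob_space (distr \<nu> borel p)" "flow_invariant \<A> \<alpha> (distr \<nu> borel p)"
proof -
  interpret N: prob_space \<nu> by fact
  have p: "p \<in> measurable \<nu> borel" using measurable_p \<nu>(1) by (simp cong: measurable_cong_sets)
  show "prob_space (distr \<nu> borel p)" by (rule N.prob_space_distr[OF p])
  then interpret D: prob_space "distr \<nu> borel p" .
  let ?\<mu> = "distr \<nu> borel p"
  have sp: "space \<nu> = UNIV" using sets_eq_imp_space_eq[OF \<nu>(1)] by simp
  have le: "emeasure ?\<mu> X \<le> emeasure ?\<mu> ((base.flow t)\<inverse> `` X)" if X: "X \<in> sets borel" for X t
  proof -
    have F: "(base.flow t)\<inverse> `` X \<in> sets borel" using X by (rule base.flow_vimage_borel)
    have "emeasure ?\<mu> X = emeasure \<nu> (p -` X)" using X p sp by (simp add: emeasure_distr)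
    also have "\<dots> = emeasure \<nu> ((cover.flow t)\<inverse> `` (p -` X))"
      using \<nu>(3) vimage_p_borel[OF X] unfolding flow_invariant_def by simp
    also have "\<dots> \<le> emeasure \<nu> (p -` ((base.flow t)\<inverse> `` X))"
    proof (rule emeasure_mono)
      show "(cover.flow t)\<inverse> `` (p -` X) \<subseteq> p -` ((base.flow t)\<inverse> `` X)"
        using flow_project by blast
    qed (use vimage_p_borel[OF F] \<nu>(1) in simp)
    also have "\<dots> = emeasure ?\<mu> ((base.flow t)\<inverse> `` X)" using F p sp by (simp add: emeasure_distr)
    finally show ?thesis .
  qed
  show "flow_invariant \<A> \<alpha> ?\<mu>"
    unfolding flow_invariant_def
  proof safe
    fix t and X :: "'a set" assume X: "X \<in> sets borel"
    let ?F = "\<lambda>X. (base.flow t)\<inverse> `` X"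
    have F: "?F X \<in> sets borel" "?F (- X) \<in> sets borel" using X base.flow_vimage_borel by auto
    \<comment> \<open>Disjointness bounds the sum of the two masses by 1, while each is at least the
      mass of its set by \<open>le\<close>; hence no slack remains.\<close>
    have "?F X \<inter> ?F (- X) = {}" using base.flow_functional by blast
    then have "measure ?\<mu> (?F X) + measure ?\<mu> (?F (- X)) = measure ?\<mu> (?F X \<union> ?F (- X))"
      using F by (intro D.finite_measure_Union[symmetric]) auto
    also have "\<dots> \<le> 1" by (rule D.prob_le_1)
    also have "1 = measure ?\<mu> X + measure ?\<mu> (- X)"
      using X D.prob_compl[of X] by (simp add: Compl_eq_Diff_UNIV)
    finally have "measure ?\<mu> (?F X) = measure ?\<mu> X"
      using le[OF X, of t] le[of "- X" t] X by (simp add: D.emeasure_eq_measure)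
    then show "emeasure ?\<mu> (?F X) = emeasure ?\<mu> X" by (simp add: D.emeasure_eq_measure)
  qed
qed

end

section \<open>Transfer of unique ergodicity to the cover\<close>

theorem corollary3:
  fixes \<A> :: "'a::{t2_space,second_countable_topology} chart set" and \<alpha> :: "'a form"
    and \<B> :: "'b::{t2_space,second_countable_topology} chart set" and \<beta> :: "'b form"
    and p :: "'b \<Rightarrow> 'a"
  assumes "translation_surface \<A> \<alpha>"
    and "translation_surface \<B> \<beta>"
    and "finite_translation_cover \<B> \<beta> \<A> \<alpha> p"
    and "finite_area \<A> \<alpha>"
    and "infinite_topological_type (UNIV :: 'a set)"
    and "flow_defined_ae \<A> \<alpha>" and "flow_ergodic \<A> \<alpha>"
    and "flow_defined_ae \<B> \<beta>" and "flow_ergodic \<B> \<beta>"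
    and "uniquely_ergodic \<A> \<alpha>"
  shows "uniquely_ergodic \<B> \<beta>"
proof -
  interpret translation_cover \<A> \<alpha> \<B> \<beta> p
    using assms(1-3) by unfold_locales
  let ?M = "cover.area" and ?n = "normalized_area \<B> \<beta>"
  \<comment> \<open>Unique ergodicity is an equality with a singleton, so it also says that the
    normalized area of the base is a probability measure.\<close>
  have "normalized_area \<A> \<alpha> \<in> {\<nu>. sets \<nu> = sets borel \<and> prob_space \<nu> \<and> flow_invariant \<A> \<alpha> \<nu>}"
    using assms(10) unfolding uniquely_ergodic_def by simp
  then interpret A: prob_space "normalized_area \<A> \<alpha>" by simp
  have fin: "emeasure ?M UNIV < \<infinity>"
    using assms(4) emeasure_cover_area_finite unfolding finite_area_def by simp
  \<comment> \<open>Zero area above would make the whole base null by surjectivity of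
    \<open>p\<close>, and a multiple of the zero measure cannot have mass 1.\<close>
  have pos: "emeasure ?M UNIV \<noteq> 0"
  proof
    assume "emeasure ?M UNIV = 0"
    then have "UNIV \<in> null_sets ?M" by (simp add: null_sets_def)
    then obtain N where "N \<in> null_sets base.area" "p ` UNIV \<subseteq> N" by (rule null_image)
    then have "emeasure base.area UNIV = 0" using surj_p by (simp add: top.extremum_unique null_sets_def)
    then show False
      using A.emeasure_space_1 by (simp add: normalized_area_def space_scale_measure)
  qed
  define r where "r = 1 / emeasure ?M UNIV"
  have r: "r \<noteq> 0" "r * emeasure ?M UNIV = 1"
    using fin pos by (auto simp: r_def ennreal_divide_eq_0_iff ennreal_divide_times)
  have n: "?n = scale_measure r ?M" unfolding normalized_area_def r_def ..
  \<comment> \<open>With equal null sets, absolute continuity and almost-everywhere statements may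
    be moved freely between the area and its normalization.\<close>
  have null: "null_sets ?n = null_sets ?M" using r(1) by (auto simp: n null_sets_def)
  have sets_n: "sets ?n = sets borel" and space_n: "space ?n = UNIV" by (auto simp: n space_scale_measure)
  have prob_n: "prob_space ?n" by (rule prob_spaceI) (simp add: n space_scale_measure r)
  have inv_n: "flow_invariant \<B> \<beta> ?n"
    using cover.area_flow_invariant[OF assms(8)] unfolding flow_invariant_def n by simp
  have "\<nu> = ?n" if \<nu>: "sets \<nu> = sets borel" "prob_space \<nu>" "flow_invariant \<B> \<beta> \<nu>" for \<nu>
  proof (rule absolutely_continuous_invariant_eq_ergodic[where T = "\<lambda>t A. (cover.flow t)\<inverse> `` A", OF prob_n \<nu>(2)])
    have "distr \<nu> borel p \<in> {\<nu>. sets \<nu> = sets borel \<and> prob_space \<nu> \<and> flow_invariant \<A> \<alpha> \<nu>}"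
      using distr_flow_invariant[OF \<nu>] by simp
    then have D: "distr \<nu> borel p = normalized_area \<A> \<alpha>"
      using assms(10) unfolding uniquely_ergodic_def by blast
    have p: "p \<in> measurable \<nu> borel" using measurable_p \<nu>(1) by (simp cong: measurable_cong_sets)
    show "absolutely_continuous ?n \<nu>"
      unfolding absolutely_continuous_def null
    proof
      fix E assume E: "E \<in> null_sets ?M"
      then obtain N where N: "N \<in> null_sets base.area" "p ` E \<subseteq> N" by (rule null_image)
      have Nb: "N \<in> sets borel" using N(1) by (auto simp: null_sets_def)
      have "emeasure \<nu> E \<le> emeasure \<nu> (p -` N)"
        using N(2) vimage_p_borel[OF Nb] \<nu>(1) by (intro emeasure_mono) auto
      also have "\<dots> = emeasure (distr \<nu> borel p) N"
        using p Nb sets_eq_imp_space_eq[OF \<nu>(1)] by (simp add: emeasure_distr)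
      also have "\<dots> = 0" unfolding D normalized_area_def using N(1) by (simp add: null_sets_def)
      finally show "E \<in> null_sets \<nu>" using E \<nu>(1) by (simp add: null_sets_def)
    qed
    show "sets \<nu> = sets ?n" using \<nu>(1) sets_n by simp
    fix A assume "A \<in> sets ?n"
    then have A: "A \<in> sets borel" using sets_n by simp
    show "(cover.flow t)\<inverse> `` A \<in> sets ?n" for t using cover.flow_vimage_borel[OF A] sets_n by simp
    show "emeasure ?n ((cover.flow t)\<inverse> `` A) = emeasure ?n A"
      "emeasure \<nu> ((cover.flow t)\<inverse> `` A) = emeasure \<nu> A" for t
      using inv_n \<nu>(3) A unfolding flow_invariant_def by auto
    assume "\<And>t. AE x in ?n. x \<in> (cover.flow t)\<inverse> `` A \<longleftrightarrow> x \<in> A"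
    then have "AE x in ?M. x \<in> (cover.flow t)\<inverse> `` A \<longleftrightarrow> x \<in> A" for t
      unfolding eventually_ae_filter null space_n by simp
    then have "emeasure ?M A = 0 \<or> emeasure ?M (- A) = 0"
      using assms(9) A unfolding flow_ergodic_def by blast
    then show "emeasure ?n A = 0 \<or> emeasure ?n (space ?n - A) = 0"
      unfolding space_n unfolding n emeasure_scale_measure Compl_eq_Diff_UNIV by (metis mult_zero_right)
  qed
  then show ?thesis
    unfolding uniquely_ergodic_def using sets_n prob_n inv_n by blast
qed

end
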